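(* Let $h_1,h_2,\dots$ be real-valued independent identically distributed random variables on a probability space $(\Omega,\mathcal F,\mathbb P)$. For $\varepsilon>0$, $t>0$, $N\in\mathbb N$ define $\delta_t(\varepsilon)=\mathbb E(h_1\mathbf 1_{\{|h_1|\le\varepsilon t\}})$, $\delta_t=\delta_t(1)$; $\pi_N(\varepsilon)=\mathbb P\big(\big|\frac1N\sum_{n=1}^N h_n-\delta_N\big|>\varepsilon\big)$; $\tau_t(\varepsilon)=t\,\mathbb P(|h_1|>\varepsilon t)$; $\sigma_t(\varepsilon)=\frac1t\mathbb E(h_1^2\mathbf 1_{\{|h_1|\le\varepsilon t\}})$; $v_t(\varepsilon)=\frac1t\mathrm{Var}(h_1\mathbf 1_{\{|h_1|\le\varepsilon t\}})$; $\rho_t(\varepsilon)=\frac1t\mathbb E\big((|h_1|\wedge\varepsilon t)^2\big)$. Then the following are equivalent: (i) there exist real numbers $d_1,d_2,\dots$ such that for each $\varepsilon>0$, $\mathbb P\big(\big|\frac1N\sum_{n=1}^N h_n-d_N\big|>\varepsilon\big)\to0$ as $N\to\infty$; (ii) $\lim_{M\to\infty}\tau_M(\varepsilon)=0$ for every $\varepsilon>0$; (ii)$'$ $\lim_{M\to\infty}\sigma_M(\varepsilon)=0$ for every $\varepsilon>0$; (ii)$''$ $\lim_{M\to\infty}v_M(\varepsilon)=0$ for every $\varepsilon>0$; (ii)$'''$ $\lim_{M\to\infty}\rho_M(\varepsilon)=0$ for every $\varepsilon>0$; (iii) $\lim_{M\to\infty}\frac1M\int_0^M\tau_t(\varepsilon)\,dt=0$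 for every $\varepsilon>0$; (iii)$'$ $\lim_{M\to\infty}M\int_M^\infty\frac{\sigma_t(\varepsilon)}{t^2}\,dt=0$ for every $\varepsilon>0$; (iii)$''$ $\lim_{M\to\infty}M\int_M^\infty\frac{v_t(\varepsilon)}{t^2}\,dt=0$ for every $\varepsilon>0$. Moreover, when any (hence all) of (ii)–(iii)$''$ hold, (i) holds with $d_N=\delta_N$, i.e. $\pi_N(\varepsilon)\to0$ for every $\varepsilon>0$. *)

theory Defs
  imports "HOL-Probability.Probability"
begin

definition trunc_mean :: "'a measure \<Rightarrow> ('a \<Rightarrow> real) \<Rightarrow> real \<Rightarrow> real \<Rightarrow> real" where
  "trunc_mean M X eps t =
     (LINT \<omega>|M. X \<omega> * indicator {\<omega> \<in> space M. \<bar>X \<omega>\<bar> \<le> eps * t} \<omega>)"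

definition tail_tau :: "'a measure \<Rightarrow> ('a \<Rightarrow> real) \<Rightarrow> real \<Rightarrow> real \<Rightarrow> real" where
  "tail_tau M X eps t = t * measure M {\<omega> \<in> space M. \<bar>X \<omega>\<bar> > eps * t}"

definition trunc_sigma :: "'a measure \<Rightarrow> ('a \<Rightarrow> real) \<Rightarrow> real \<Rightarrow> real \<Rightarrow> real" where
  "trunc_sigma M X eps t =
     (1 / t) * (LINT \<omega>|M. (X \<omega>)\<^sup>2 * indicator {\<omega> \<in> space M. \<bar>X \<omega>\<bar> \<le> eps * t} \<omega>)"

definition trunc_var :: "'a measure \<Rightarrow> ('a \<Rightarrow> real) \<Rightarrow> real \<Rightarrow> real \<Rightarrow> real" where
  "trunc_var M X eps t =
     (1 / t) * (LINT \<omega>|M.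
        (X \<omega> * indicator {\<omega> \<in> space M. \<bar>X \<omega>\<bar> \<le> eps * t} \<omega> - trunc_mean M X eps t)\<^sup>2)"

definition trunc_rho :: "'a measure \<Rightarrow> ('a \<Rightarrow> real) \<Rightarrow> real \<Rightarrow> real \<Rightarrow> real" where
  "trunc_rho M X eps t = (1 / t) * (LINT \<omega>|M. (min \<bar>X \<omega>\<bar> (eps * t))\<^sup>2)"

definition avg_dev_prob :: "'a measure \<Rightarrow> (nat \<Rightarrow> 'a \<Rightarrow> real) \<Rightarrow> nat \<Rightarrow> real \<Rightarrow> real \<Rightarrow> real" where
  "avg_dev_prob M h N d eps =
     measure M {\<omega> \<in> space M. \<bar>(1 / real N) * (\<Sum>n\<in>{1..N}. h n \<omega>) - d\<bar> > eps}"

end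

theory Submission
  imports Defs "HOL-Real_Asymp.Real_Asymp"
begin

text \<open>
  For fixed \<open>\<epsilon>\<close> each of the conditions (ii) to (iii)'' is equivalent to \<open>\<rho>\<^sub>t(\<epsilon>) \<longlonglongrightarrow> 0\<close>. By Fubini,
  the averages in (iii) and (iii)' are \<open>\<rho>\<^sub>M(\<epsilon>) / (2 \<epsilon>\<^sup>2)\<close> and \<open>\<rho>\<^sub>M(\<epsilon>) / 2\<close>, so (ii) and (ii)' imply
  \<open>\<rho> \<longlonglongrightarrow> 0\<close> by averaging; conversely \<open>\<rho> = \<sigma> + \<epsilon>\<^sup>2 \<tau>\<close>. Variance and second moment are linked by
  \<open>v\<^sub>t \<le> \<sigma>\<^sub>t \<le> 5 v\<^sub>t + A / t\<close>. Truncation at level \<open>N\<close> and Chebyshev's inequality give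
  \<open>\<pi>\<^sub>N(\<epsilon>) \<le> \<tau>\<^sub>N(1) + v\<^sub>N(1) / \<epsilon>\<^sup>2\<close>, hence (i). The converse needs no symmetrization: by the
  Bonferroni inequality, with probability at least of the order of \<open>min (N P(\<bar>h\<^sub>1\<bar> > \<epsilon> N)) 1\<close> some \<open>h\<^sub>k\<close>
  exceeds \<open>\<epsilon> N\<close> in modulus while the sum of the others stays near \<open>N d\<^sub>N\<close>.
\<close>

section \<open>Elementary integrals over intervals and half-lines, and criteria for limits at
  infinity\<close>

lemma has_bochner_integral_inverse_square_tail:
  assumes "0 < (m::real)"
  shows "has_bochner_integral lborel (\<lambda>t. indicator {m<..} t * (1 / t\<^sup>2)) (1 / m)"
proof -
  let ?f = "\<lambda>t::real. 1 / t\<^sup>2" and ?F = "\<lambda>t::real. - 1 / t"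
  have A: "((?F \<circ> real_of_ereal) \<longlongrightarrow> - 1 / m) (at_right (ereal m))"
    unfolding comp_def ereal_tendsto_simps1 using assms by (intro tendsto_intros) auto
  have "(?F \<longlongrightarrow> 0) at_top" by real_asymp
  then have B: "((?F \<circ> real_of_ereal) \<longlongrightarrow> 0) (at_left \<infinity>)"
    unfolding ereal_tendsto_simps1 .
  have D: "DERIV ?F t :> ?f t" if "m < t" for t
    using assms that by (auto intro!: derivative_eq_intros simp: power2_eq_square)
  have C: "isCont ?f t" if "m < t" for t
    using assms that by (intro continuous_intros) auto
  have "set_integrable lborel (einterval (ereal m) \<infinity>) ?f"
    "(LBINT t=ereal m..\<infinity>. ?f t) = 0 - (- 1 / m)"
    by (rule interval_integral_FTC_nonneg[where F = ?F]; use A B C D in auto)+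
  then show ?thesis
    by (simp add: has_bochner_integral_iff interval_integral_to_infinity_eq
        set_integrable_def set_lebesgue_integral_def)
qed

text \<open>The cube is the weight that arises when \<open>trunc_sigma\<close>, itself carrying a
  factor \<open>1 / t\<close>, is divided by \<open>t\<^sup>2\<close>.\<close>

lemma has_bochner_integral_inverse_cube_tail:
  assumes "0 < (m::real)"
  shows "has_bochner_integral lborel (\<lambda>t. indicator {m<..} t * (1 / t ^ 3)) (1 / (2 * m\<^sup>2))"
proof -
  let ?f = "\<lambda>t::real. 1 / t ^ 3" and ?F = "\<lambda>t::real. - 1 / (2 * t\<^sup>2)"
  have A: "((?F \<circ> real_of_ereal) \<longlongrightarrow> - 1 / (2 * m\<^sup>2)) (at_right (ereal m))"
    unfolding comp_def ereal_tendsto_simps1 using assms by (intro tendsto_intros) auto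
  have "(?F \<longlongrightarrow> 0) at_top" by real_asymp
  then have B: "((?F \<circ> real_of_ereal) \<longlongrightarrow> 0) (at_left \<infinity>)"
    unfolding ereal_tendsto_simps1 .
  have D: "DERIV ?F t :> ?f t" if "m < t" for t
    using assms that
    by (auto intro!: derivative_eq_intros simp: power2_eq_square power3_eq_cube field_simps)
  have C: "isCont ?f t" if "m < t" for t
    using assms that by (intro continuous_intros) auto
  have "set_integrable lborel (einterval (ereal m) \<infinity>) ?f"
    "(LBINT t=ereal m..\<infinity>. ?f t) = 0 - (- 1 / (2 * m\<^sup>2))"
    by (rule interval_integral_FTC_nonneg[where F = ?F]; use A B C D assms in auto)+
  then show ?thesis
    by (simp add: has_bochner_integral_iff interval_integral_to_infinity_eq
        set_integrable_def set_lebesgue_integral_def)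
qed

lemma has_bochner_integral_id_Ioo:
  assumes "0 \<le> (m::real)"
  shows "has_bochner_integral lborel (\<lambda>t. indicator {0<..<m} t * t) (m\<^sup>2 / 2)"
proof -
  have "has_bochner_integral lborel (\<lambda>t. t * indicator {0..m} t) (m\<^sup>2 / 2 - 0\<^sup>2 / 2)"
    using assms
    by (intro has_bochner_integral_FTC_Icc_real) (auto intro!: derivative_eq_intros continuous_intros)
  then have "has_bochner_integral lborel (\<lambda>t. t * indicator {0..m} t) (m\<^sup>2 / 2)" by simp
  \<comment> \<open>The fundamental theorem gives the closed interval. The endpoint \<open>m\<close>
    is a null set, and at \<open>0\<close> the factor \<open>t\<close> makes both integrands
    vanish.\<close>
  moreover have "AE t in lborel. t \<noteq> m" by (rule AE_lborel_singleton)
  then have "AE t in lborel. t * indicator {0..m} t = indicator {0<..<m} t * t"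
    by eventually_elim (auto simp: indicator_def)
  ultimately show ?thesis
    by (subst (asm) has_bochner_integral_cong_AE[where g = "\<lambda>t. indicator {0<..<m} t * t"]) auto
qed

text \<open>The slack \<open>C / T\<close> absorbs what a fixed initial segment contributes to an
  average over \<open>{0<..<T}\<close>; \<open>A\<close> and \<open>C\<close> may depend on
  \<open>e\<close>.\<close>

lemma tendsto_zero_at_top_by_bound:
  fixes f :: "real \<Rightarrow> real"
  assumes "\<And>e. 0 < e \<Longrightarrow> \<exists>A C. \<forall>T>0. A \<le> T \<longrightarrow> 0 \<le> f T \<and> f T \<le> e + C / T"
  shows "(f \<longlongrightarrow> 0) at_top"
proof (rule tendstoI)
  fix e :: real assume "0 < e"
  then obtain A C where AC: "\<And>T. 0 < T \<Longrightarrow> A \<le> T \<Longrightarrow> 0 \<le> f T \<and> f T \<le> e / 2 + C / T"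
    using assms[of "e / 2"] by auto
  have "((\<lambda>T. C / T) \<longlongrightarrow> 0) at_top" by real_asymp
  then have "eventually (\<lambda>T. C / T < e / 2) at_top"
    by (rule order_tendstoD) (use \<open>0 < e\<close> in simp)
  then show "eventually (\<lambda>T. dist (f T) 0 < e) at_top"
    using eventually_gt_at_top[of 0] eventually_ge_at_top[of A]
  proof eventually_elim
    case (elim T)
    with AC[of T] show ?case unfolding dist_real_def by linarith
  qed
qed

lemma tendsto_zero_at_top_sandwich:
  fixes f :: "real \<Rightarrow> real"
  assumes "(g \<longlongrightarrow> 0) at_top" "\<And>T. 0 < T \<Longrightarrow> 0 \<le> f T" "\<And>T. 0 < T \<Longrightarrow> f T \<le> g T"
  shows "(f \<longlongrightarrow> 0) at_top"
  by (rule tendsto_sandwich[OF _ _ tendsto_const assms(1)])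
     (auto intro!: eventually_mono[OF eventually_gt_at_top[of 0]] assms(2,3))

text \<open>Since \<open>f\<close> is nonnegative, integrability of its inner integral
  \<open>g\<close> already gives joint integrability, so Fubini applies. The conclusion also records
  integrability in \<open>t\<close>, which the later comparisons of integrals require.\<close>

lemma (in prob_space) has_bochner_integral_lborel_swap:
  fixes f :: "'a \<Rightarrow> real \<Rightarrow> real"
  assumes [measurable]: "case_prod f \<in> borel_measurable (M \<Otimes>\<^sub>M lborel)"
    and nonneg: "\<And>\<omega> t. 0 \<le> f \<omega> t"
    and inner: "\<And>\<omega>. has_bochner_integral lborel (f \<omega>) (g \<omega>)"
    and g: "integrable M g"
  shows "has_bochner_integral lborel (\<lambda>t. LINT \<omega>|M. f \<omega> t) (LINT \<omega>|M. g \<omega>)"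
proof -
  interpret P: pair_sigma_finite M lborel by unfold_locales
  have eq: "integral\<^sup>L lborel (f \<omega>) = g \<omega>" "integrable lborel (f \<omega>)" for \<omega>
    using inner[of \<omega>] by (simp_all add: has_bochner_integral_iff)
  have int: "integrable (M \<Otimes>\<^sub>M lborel) (case_prod f)"
    by (rule P.Fubini_integrable) (auto simp: nonneg eq g)
  show ?thesis
    using P.integrable_snd[OF int] P.Fubini_integral[OF int] by (simp add: has_bochner_integral_iff eq)
qed

section \<open>Truncated moments of a single random variable\<close>

context prob_space
begin

context
  fixes X :: "'a \<Rightarrow> real"
  assumes X[measurable]: "random_variable borel X"
begin

lemma integrable_trunc:
  "integrable M (\<lambda>\<omega>. X \<omega> * indicator {\<omega> \<in> space M. \<bar>X \<omega>\<bar> \<le> c} \<omega>)"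
  by (rule integrable_const_bound[where B = "\<bar>c\<bar>"]) (auto simp: indicator_def)

lemma integrable_trunc_sq:
  "integrable M (\<lambda>\<omega>. (X \<omega>)\<^sup>2 * indicator {\<omega> \<in> space M. \<bar>X \<omega>\<bar> \<le> c} \<omega>)"
proof (rule integrable_const_bound[where B = "c\<^sup>2"])
  have "x\<^sup>2 \<le> c\<^sup>2" if "\<bar>x\<bar> \<le> c" for x :: real
    using power_mono[OF that, of 2] by simp
  then show "AE \<omega> in M. norm ((X \<omega>)\<^sup>2 * indicator {\<omega> \<in> space M. \<bar>X \<omega>\<bar> \<le> c} \<omega>) \<le> c\<^sup>2"
    by (auto simp: indicator_def)
qed measurable

lemma integrable_min_sq:
  assumes "0 \<le> c"
  shows "integrable M (\<lambda>\<omega>. (min \<bar>X \<omega>\<bar> c)\<^sup>2)"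
  by (rule integrable_const_bound[where B = "c\<^sup>2"]) (use assms in \<open>auto intro!: power_mono\<close>)

text \<open>A layer-cake formula: for fixed \<open>\<omega>\<close> the admissible \<open>t\<close>
  fill the interval from \<open>0\<close> to \<open>min T (\<bar>X \<omega>\<bar> / eps)\<close>,
  over which \<open>t\<close> integrates to half the square of the upper end.\<close>

lemma has_bochner_integral_tail_tau:
  assumes "0 < eps" "0 < T"
  shows "has_bochner_integral lborel (\<lambda>t. indicator {0<..<T} t * tail_tau M X eps t)
    (T * trunc_rho M X eps T / (2 * eps\<^sup>2))"
proof -
  let ?f = "\<lambda>\<omega> t. indicator {0<..<T} t * (t * indicator {\<omega>\<in>space M. \<bar>X \<omega>\<bar> > eps * t} \<omega>) :: real"
  \<comment> \<open>Unlike \<open>?f\<close>, this form does not mention \<open>space M\<close>, so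
    its inner integral has the required value for every \<open>\<omega>\<close>. The two agree on
    \<open>space M\<close>.\<close>
  let ?f' = "\<lambda>\<omega> t. indicator {0<..<min T (\<bar>X \<omega>\<bar> / eps)} t * t :: real"
  have inner: "(min T (\<bar>x\<bar> / eps))\<^sup>2 / 2 = (min \<bar>x\<bar> (eps * T))\<^sup>2 / (2 * eps\<^sup>2)" for x :: real
  proof -
    have "min T (\<bar>x\<bar> / eps) = min \<bar>x\<bar> (eps * T) / eps"
      using assms by (auto simp: min_def field_simps)
    then show ?thesis by (simp add: power_divide field_simps)
  qed
  have "has_bochner_integral lborel (\<lambda>t. LINT \<omega>|M. ?f' \<omega> t)
      (LINT \<omega>|M. (min \<bar>X \<omega>\<bar> (eps * T))\<^sup>2 / (2 * eps\<^sup>2))"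
  proof (rule has_bochner_integral_lborel_swap)
    show "has_bochner_integral lborel (?f' \<omega>) ((min \<bar>X \<omega>\<bar> (eps * T))\<^sup>2 / (2 * eps\<^sup>2))" for \<omega>
      using has_bochner_integral_id_Ioo[of "min T (\<bar>X \<omega>\<bar> / eps)"] assms unfolding inner by simp
    have "(\<lambda>p. if 0 < snd p \<and> snd p < T \<and> snd p < \<bar>X (fst p)\<bar> / eps then snd p else 0)
        \<in> borel_measurable (M \<Otimes>\<^sub>M lborel)" (is "?g \<in> _")
      by measurable
    also have "?g = case_prod ?f'"
      by (auto simp: fun_eq_iff indicator_def)
    finally show "case_prod ?f' \<in> borel_measurable (M \<Otimes>\<^sub>M lborel)" .
    show "0 \<le> ?f' \<omega> t" for \<omega> t by (simp add: indicator_def)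
    show "integrable M (\<lambda>\<omega>. (min \<bar>X \<omega>\<bar> (eps * T))\<^sup>2 / (2 * eps\<^sup>2))"
      using assms by (intro integrable_divide integrable_min_sq) auto
  qed
  moreover have "(LINT \<omega>|M. ?f' \<omega> t) = indicator {0<..<T} t * tail_tau M X eps t" for t
  proof -
    have "(LINT \<omega>|M. ?f' \<omega> t) = (LINT \<omega>|M. ?f \<omega> t)"
      by (rule Bochner_Integration.integral_cong) (use assms in \<open>auto simp: indicator_def field_simps\<close>)
    also have "\<dots> = indicator {0<..<T} t * tail_tau M X eps t"
      by (simp add: tail_tau_def)
    finally show ?thesis .
  qed
  moreover have "(LINT \<omega>|M. (min \<bar>X \<omega>\<bar> (eps * T))\<^sup>2 / (2 * eps\<^sup>2)) = T * trunc_rho M X eps T / (2 * eps\<^sup>2)"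
    using assms by (simp add: trunc_rho_def)
  ultimately show ?thesis by (simp only:)
qed

text \<open>Dual to the layer-cake formula: for fixed \<open>\<omega>\<close> the admissible
  \<open>t\<close> form a half-line, over which \<open>1 / t ^ 3\<close> is integrated.\<close>

lemma has_bochner_integral_trunc_sigma:
  assumes "0 < eps" "0 < T"
  shows "has_bochner_integral lborel (\<lambda>t. indicator {T<..} t * (trunc_sigma M X eps t / t\<^sup>2))
    (trunc_rho M X eps T / (2 * T))"
proof -
  let ?f = "\<lambda>\<omega> t. indicator {T<..} t * ((X \<omega>)\<^sup>2 * indicator {\<omega>\<in>space M. \<bar>X \<omega>\<bar> \<le> eps * t} \<omega> / t ^ 3) :: real"
  let ?f' = "\<lambda>\<omega> t. (if T < t \<and> \<bar>X \<omega>\<bar> \<le> eps * t then (X \<omega>)\<^sup>2 / t ^ 3 else 0) :: real"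
  have "has_bochner_integral lborel (\<lambda>t. LINT \<omega>|M. ?f' \<omega> t)
      (LINT \<omega>|M. (min \<bar>X \<omega>\<bar> (eps * T))\<^sup>2 / (2 * T\<^sup>2))"
  proof (rule has_bochner_integral_lborel_swap)
    show "has_bochner_integral lborel (?f' \<omega>) ((min \<bar>X \<omega>\<bar> (eps * T))\<^sup>2 / (2 * T\<^sup>2))" for \<omega>
    proof -
      \<comment> \<open>The left end of that half-line: both \<open>T < t\<close> and
        \<open>\<bar>X \<omega>\<bar> / eps \<le> t\<close> must hold.\<close>
      define m where "m = max T (\<bar>X \<omega>\<bar> / eps)"
      have m: "0 < m" using assms by (simp add: m_def)
      have "\<bar>X \<omega>\<bar> / m = min \<bar>X \<omega>\<bar> (eps * T) / T"
        using assms by (auto simp: m_def min_def max_def field_simps)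
      then have "(\<bar>X \<omega>\<bar> / m)\<^sup>2 / 2 = (min \<bar>X \<omega>\<bar> (eps * T) / T)\<^sup>2 / 2" by simp
      then have val: "(X \<omega>)\<^sup>2 * (1 / (2 * m\<^sup>2)) = (min \<bar>X \<omega>\<bar> (eps * T))\<^sup>2 / (2 * T\<^sup>2)"
        by (simp add: power_divide field_simps)
      have *: "has_bochner_integral lborel (\<lambda>t. (X \<omega>)\<^sup>2 * (indicator {m<..} t * (1 / t ^ 3)))
          ((X \<omega>)\<^sup>2 * (1 / (2 * m\<^sup>2)))"
        using has_bochner_integral_inverse_cube_tail[OF m]
        by (rule has_bochner_integral_mult_right)
      \<comment> \<open>The point \<open>m\<close> is excluded because one constraint is strict and
        the other is not; at \<open>t = m\<close> the equivalence fails when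
        \<open>m > T\<close>.\<close>
      have dom: "(T < t \<and> \<bar>X \<omega>\<bar> \<le> eps * t) \<longleftrightarrow> m < t" if "t \<noteq> m" for t
      proof -
        have "\<bar>X \<omega>\<bar> \<le> eps * t \<longleftrightarrow> \<bar>X \<omega>\<bar> / eps \<le> t"
          using assms by (simp add: pos_divide_le_eq mult.commute)
        then show ?thesis using that unfolding m_def by (smt (verit))
      qed
      have "AE t in lborel. t \<noteq> m" by (rule AE_lborel_singleton)
      then have "AE t in lborel. (X \<omega>)\<^sup>2 * (indicator {m<..} t * (1 / t ^ 3)) = ?f' \<omega> t"
        by eventually_elim (simp add: dom indicator_def)
      then show ?thesis
        using * unfolding val
        by (subst (asm) has_bochner_integral_cong_AE[where g = "?f' \<omega>"]) auto
    qed
    have "(\<lambda>p. if T < snd p \<and> \<bar>X (fst p)\<bar> \<le> eps * snd p then (X (fst p))\<^sup>2 / snd p ^ 3 else 0)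
        \<in> borel_measurable (M \<Otimes>\<^sub>M lborel)"
      by measurable
    then show "case_prod ?f' \<in> borel_measurable (M \<Otimes>\<^sub>M lborel)"
      by (simp add: split_beta')
    show "0 \<le> ?f' \<omega> t" for \<omega> t using assms by auto
    show "integrable M (\<lambda>\<omega>. (min \<bar>X \<omega>\<bar> (eps * T))\<^sup>2 / (2 * T\<^sup>2))"
      using assms by (intro integrable_divide integrable_min_sq) auto
  qed
  moreover have "(LINT \<omega>|M. ?f' \<omega> t) = indicator {T<..} t * (trunc_sigma M X eps t / t\<^sup>2)" for t
  proof -
    have "(LINT \<omega>|M. ?f' \<omega> t) = (LINT \<omega>|M. ?f \<omega> t)"
      by (rule Bochner_Integration.integral_cong) (auto simp: indicator_def)
    also have "\<dots> = indicator {T<..} t * (trunc_sigma M X eps t / t\<^sup>2)"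
      by (simp add: trunc_sigma_def power3_eq_cube power2_eq_square)
    finally show ?thesis .
  qed
  moreover have "(LINT \<omega>|M. (min \<bar>X \<omega>\<bar> (eps * T))\<^sup>2 / (2 * T\<^sup>2)) = trunc_rho M X eps T / (2 * T)"
    using assms by (simp add: trunc_rho_def power2_eq_square)
  ultimately show ?thesis by (simp only:)
qed

lemma trunc_rho_eq:
  assumes "0 < T" "0 < eps"
  shows "trunc_rho M X eps T = trunc_sigma M X eps T + eps\<^sup>2 * tail_tau M X eps T"
proof -
  have "(LINT \<omega>|M. (min \<bar>X \<omega>\<bar> (eps * T))\<^sup>2) =
    (LINT \<omega>|M. (X \<omega>)\<^sup>2 * indicator {\<omega> \<in> space M. \<bar>X \<omega>\<bar> \<le> eps * T} \<omega>
       + (eps * T)\<^sup>2 * indicator {\<omega> \<in> space M. \<bar>X \<omega>\<bar> > eps * T} \<omega>)"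
    by (rule Bochner_Integration.integral_cong) (auto simp: indicator_def min_def)
  also have "\<dots> = (LINT \<omega>|M. (X \<omega>)\<^sup>2 * indicator {\<omega> \<in> space M. \<bar>X \<omega>\<bar> \<le> eps * T} \<omega>)
      + (eps * T)\<^sup>2 * prob {\<omega> \<in> space M. \<bar>X \<omega>\<bar> > eps * T}"
    by (subst Bochner_Integration.integral_add)
       (auto intro!: integrable_trunc_sq simp: less_top[symmetric])
  finally show ?thesis
    using assms unfolding trunc_rho_def trunc_sigma_def tail_tau_def
    by (simp add: field_simps power2_eq_square)
qed

lemma trunc_var_eq:
  assumes "0 < T"
  shows "trunc_var M X eps T = trunc_sigma M X eps T - (trunc_mean M X eps T)\<^sup>2 / T"
proof -
  let ?Y = "\<lambda>\<omega>. X \<omega> * indicator {\<omega> \<in> space M. \<bar>X \<omega>\<bar> \<le> eps * T} \<omega>"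
  have sq: "(?Y \<omega>)\<^sup>2 = (X \<omega>)\<^sup>2 * indicator {\<omega> \<in> space M. \<bar>X \<omega>\<bar> \<le> eps * T} \<omega>" for \<omega>
    by (simp add: indicator_def)
  have "variance ?Y = expectation (\<lambda>\<omega>. (?Y \<omega>)\<^sup>2) - (expectation ?Y)\<^sup>2"
    by (rule variance_eq) (simp_all only: sq integrable_trunc integrable_trunc_sq)
  then show ?thesis
    unfolding sq trunc_var_def trunc_sigma_def trunc_mean_def by (simp add: diff_divide_distrib)
qed

text \<open>The variance is not a single expectation linear in a nonnegative integrand, so Fubini
  does not treat it directly. Its integrability will come from domination by
  \<open>trunc_sigma\<close>, for which measurability in \<open>t\<close> is wanted.\<close>

lemma borel_measurable_trunc_var_tail:
  assumes "0 < T"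
  shows "(\<lambda>t. indicator {T<..} t * (trunc_var M X eps t / t\<^sup>2)) \<in> borel_measurable lborel"
proof -
  \<comment> \<open>The \<open>if\<close> form exposes joint measurability in \<open>t\<close> and
    \<open>\<omega>\<close>, so the parametrised integral is measurable.\<close>
  have 1: "(\<lambda>t. LINT \<omega>|M. (if \<bar>X \<omega>\<bar> \<le> eps * t then X \<omega> else 0)) \<in> borel_measurable borel"
    by measurable
  have 2: "(\<lambda>t. LINT \<omega>|M. (if \<bar>X \<omega>\<bar> \<le> eps * t then (X \<omega>)\<^sup>2 else 0)) \<in> borel_measurable borel"
    by measurable
  have [measurable]: "trunc_mean M X eps \<in> borel_measurable borel"
    "(\<lambda>t. trunc_sigma M X eps t) \<in> borel_measurable borel"
    using 1 2 unfolding trunc_mean_def[abs_def] trunc_sigma_def[abs_def]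
    by (auto intro!: borel_measurable_times borel_measurable_divide 
       intro: back_subst[where P = "\<lambda>f. f \<in> borel_measurable borel"] Bochner_Integration.integral_cong simp: indicator_def fun_eq_iff)
  have "(\<lambda>t. indicator {T<..} t * ((trunc_sigma M X eps t - (trunc_mean M X eps t)\<^sup>2 / t) / t\<^sup>2))
     \<in> borel_measurable lborel" by measurable
  also have "(\<lambda>t. indicator {T<..} t * ((trunc_sigma M X eps t - (trunc_mean M X eps t)\<^sup>2 / t) / t\<^sup>2))
    = (\<lambda>t. indicator {T<..} t * (trunc_var M X eps t / t\<^sup>2))"
    using assms by (auto simp: fun_eq_iff trunc_var_eq indicator_def)
  finally show ?thesis .
qed

text \<open>The tail is one minus the distribution function of \<open>\<bar>X\<bar>\<close>.\<close>

lemma prob_abs_gt_tendsto_0: "((\<lambda>t. prob {\<omega> \<in> space M. \<bar>X \<omega>\<bar> > t}) \<longlongrightarrow> 0) at_top"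
proof -
  let ?D = "distr M borel (\<lambda>\<omega>. \<bar>X \<omega>\<bar>)"
  interpret D: real_distribution ?D by (rule real_distribution_distr) measurable
  have "1 - cdf ?D t = prob {\<omega> \<in> space M. \<bar>X \<omega>\<bar> > t}" for t
  proof -
    have "prob {\<omega> \<in> space M. \<not> \<bar>X \<omega>\<bar> \<le> t} = 1 - prob {\<omega> \<in> space M. \<bar>X \<omega>\<bar> \<le> t}"
      by (rule prob_neg) measurable
    also have "prob {\<omega> \<in> space M. \<bar>X \<omega>\<bar> \<le> t} = cdf ?D t"
      by (auto simp: cdf_def measure_distr intro!: arg_cong[where f = prob])
    finally show ?thesis by (simp add: not_le)
  qed
  moreover have "((\<lambda>t. 1 - cdf ?D t) \<longlongrightarrow> 1 - 1) at_top"
    by (intro tendsto_intros D.cdf_lim_at_top_prob)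
  ultimately show ?thesis by simp
qed

lemma trunc_var_nonneg: "0 < T \<Longrightarrow> 0 \<le> trunc_var M X eps T"
  unfolding trunc_var_def by simp

lemma trunc_sigma_nonneg: "0 < T \<Longrightarrow> 0 \<le> trunc_sigma M X eps T"
  unfolding trunc_sigma_def by (simp add: integral_nonneg_AE)

lemma tail_tau_nonneg: "0 < T \<Longrightarrow> 0 \<le> tail_tau M X eps T"
  unfolding tail_tau_def by simp

lemma trunc_rho_nonneg: "0 < T \<Longrightarrow> 0 \<le> trunc_rho M X eps T"
  unfolding trunc_rho_def by simp

lemma trunc_var_le_sigma: "0 < T \<Longrightarrow> trunc_var M X eps T \<le> trunc_sigma M X eps T"
  by (simp add: trunc_var_eq)

text \<open>Where \<open>\<bar>X\<bar> \<le> A\<close>, a truncated mean that is large compared with \<open>A\<close> is far from the truncated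
  variable, so the variance controls the square of the mean.\<close>
lemma trunc_sigma_le_var:
  obtains A where "\<And>eps T. 0 < T \<Longrightarrow> trunc_sigma M X eps T \<le> 5 * trunc_var M X eps T + A / T"
proof -
  have "eventually (\<lambda>t. prob {\<omega> \<in> space M. \<bar>X \<omega>\<bar> > t} < 1 / 2) at_top"
    by (rule order_tendstoD[OF prob_abs_gt_tendsto_0]) simp
  \<comment> \<open>Nonnegativity of the level ensures
    \<open>\<bar>?Y \<omega>\<bar> \<le> a\<close> also where the truncation has replaced
    \<open>X \<omega>\<close> by \<open>0\<close>.\<close>
  then have "eventually (\<lambda>t. 0 \<le> t \<and> prob {\<omega> \<in> space M. \<bar>X \<omega>\<bar> > t} < 1 / 2) at_top"
    by (intro eventually_conj eventually_ge_at_top)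
  then obtain a where a: "0 \<le> a" "prob {\<omega> \<in> space M. \<bar>X \<omega>\<bar> > a} < 1 / 2"
    using eventually_happens'[OF trivial_limit_at_top_linorder] by blast
  have "prob {\<omega> \<in> space M. \<not> \<bar>X \<omega>\<bar> > a} = 1 - prob {\<omega> \<in> space M. \<bar>X \<omega>\<bar> > a}"
    by (rule prob_neg) measurable
  with a have half: "1 / 2 \<le> prob {\<omega> \<in> space M. \<bar>X \<omega>\<bar> \<le> a}" by (simp add: not_less)
  \<comment> \<open>Origin of the constants: the squared mean divided by \<open>T\<close> is at most
    \<open>4 * trunc_var M X eps T + 4 * a\<^sup>2 / T\<close>, and \<open>trunc_sigma\<close> adds
    one further \<open>trunc_var\<close>.\<close>
  have "trunc_sigma M X eps T \<le> 5 * trunc_var M X eps T + (4 * a\<^sup>2) / T" if T: "0 < T" for eps T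
  proof -
    let ?Y = "\<lambda>\<omega>. X \<omega> * indicator {\<omega> \<in> space M. \<bar>X \<omega>\<bar> \<le> eps * T} \<omega>"
    let ?m = "trunc_mean M X eps T"
    have intY: "integrable M ?Y" by (rule integrable_trunc)
    have "(?Y \<omega>)\<^sup>2 = (X \<omega>)\<^sup>2 * indicator {\<omega> \<in> space M. \<bar>X \<omega>\<bar> \<le> eps * T} \<omega>" for \<omega>
      by (simp add: indicator_def)
    then have intY2: "integrable M (\<lambda>\<omega>. (?Y \<omega>)\<^sup>2)"
      using integrable_trunc_sq by simp
    have intV: "integrable M (\<lambda>\<omega>. (?Y \<omega> - ?m)\<^sup>2)"
      unfolding power2_diff using intY intY2 by simp
    have "?m\<^sup>2 * (1 / 2) \<le> ?m\<^sup>2 * prob {\<omega> \<in> space M. \<bar>X \<omega>\<bar> \<le> a}"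
      using half by (intro mult_left_mono) auto
    also have "\<dots> = (LINT \<omega>|M. ?m\<^sup>2 * indicator {\<omega> \<in> space M. \<bar>X \<omega>\<bar> \<le> a} \<omega>)"
      by simp
    also have "\<dots> \<le> (LINT \<omega>|M. 2 * (?Y \<omega> - ?m)\<^sup>2 + 2 * a\<^sup>2)"
    proof (rule integral_mono)
      fix \<omega> assume "\<omega> \<in> space M"
      show "?m\<^sup>2 * indicator {\<omega> \<in> space M. \<bar>X \<omega>\<bar> \<le> a} \<omega> \<le> 2 * (?Y \<omega> - ?m)\<^sup>2 + 2 * a\<^sup>2"
      proof (cases "\<bar>X \<omega>\<bar> \<le> a")
        case True
        then have "\<bar>?Y \<omega>\<bar> \<le> a" using a by (auto simp: indicator_def)
        then have 1: "(?Y \<omega>)\<^sup>2 \<le> a\<^sup>2" using power_mono[of "\<bar>?Y \<omega>\<bar>" a 2] by simp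
        \<comment> \<open>The difference of the two sides is
          \<open>(m - 2 * y)\<^sup>2\<close>.\<close>
        have "m\<^sup>2 \<le> 2 * (y - m)\<^sup>2 + 2 * y\<^sup>2" for m y :: real
          using zero_le_power2[of "m - 2 * y"] by (simp add: power2_eq_square algebra_simps)
        from this[of ?m "?Y \<omega>"] 1 have "?m\<^sup>2 \<le> 2 * (?Y \<omega> - ?m)\<^sup>2 + 2 * a\<^sup>2" by linarith
        moreover have "?m\<^sup>2 * indicator {\<omega> \<in> space M. \<bar>X \<omega>\<bar> \<le> a} \<omega> \<le> ?m\<^sup>2"
          by (simp add: indicator_def)
        ultimately show ?thesis by linarith
      qed (simp add: indicator_def)
    qed (use intV in \<open>auto simp: less_top[symmetric]\<close>)
    also have "\<dots> = 2 * (LINT \<omega>|M. (?Y \<omega> - ?m)\<^sup>2) + 2 * a\<^sup>2"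
      using intV by (simp add: prob_space)
    also have "(LINT \<omega>|M. (?Y \<omega> - ?m)\<^sup>2) = T * trunc_var M X eps T"
      using T by (simp add: trunc_var_def)
    finally have m2: "?m\<^sup>2 \<le> 4 * (T * trunc_var M X eps T) + 4 * a\<^sup>2" by simp
    have "?m\<^sup>2 / T \<le> (4 * (T * trunc_var M X eps T) + 4 * a\<^sup>2) / T"
      using divide_right_mono[OF m2 less_imp_le[OF T]] .
    also have "\<dots> = 4 * trunc_var M X eps T + 4 * a\<^sup>2 / T"
      using T unfolding add_divide_distrib by simp
    finally show ?thesis
      using trunc_var_eq[OF T, of eps] by linarith
  qed
  then show thesis by (rule that[of "4 * a\<^sup>2"])
qed

section \<open>Equivalence of the asymptotic conditions for fixed \<open>eps\<close>\<close>

context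
  fixes eps :: real
  assumes eps: "0 < eps"
begin

lemma average_tail_tau:
  assumes "0 < T"
  shows "(1 / T) * (LBINT t=ereal 0..ereal T. tail_tau M X eps t)
    = trunc_rho M X eps T / (2 * eps\<^sup>2)"
proof -
  have "(LBINT t=ereal 0..ereal T. tail_tau M X eps t) = T * trunc_rho M X eps T / (2 * eps\<^sup>2)"
    using has_bochner_integral_tail_tau[OF eps assms] assms
    by (simp add: interval_integral_Ioo set_lebesgue_integral_def has_bochner_integral_iff)
  with assms show ?thesis by simp
qed

lemma tail_integral_trunc_sigma:
  assumes "0 < T"
  shows "T * (LBINT t=ereal T..\<infinity>. trunc_sigma M X eps t / t\<^sup>2) = trunc_rho M X eps T / 2"
  using has_bochner_integral_trunc_sigma[OF eps assms] assms
  by (simp add: interval_integral_to_infinity_eq set_lebesgue_integral_def has_bochner_integral_iff)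

text \<open>One direction is the comparison \<open>eps\<^sup>2 * tail_tau \<le> trunc_rho\<close>.
  The other is a Cesaro argument, as \<open>trunc_rho / (2 * eps\<^sup>2)\<close> is the average of
  \<open>tail_tau\<close> over \<open>{0<..<T}\<close>.\<close>

lemma tail_tau_tendsto_iff_trunc_rho:
  "((\<lambda>T. tail_tau M X eps T) \<longlongrightarrow> 0) at_top \<longleftrightarrow> ((\<lambda>T. trunc_rho M X eps T) \<longlongrightarrow> 0) at_top"
proof
  assume rho: "((\<lambda>T. trunc_rho M X eps T) \<longlongrightarrow> 0) at_top"
  have "((\<lambda>T. trunc_rho M X eps T / eps\<^sup>2) \<longlongrightarrow> 0 / eps\<^sup>2) at_top"
    using eps by (intro tendsto_divide rho tendsto_const) auto
  then have lim: "((\<lambda>T. trunc_rho M X eps T / eps\<^sup>2) \<longlongrightarrow> 0) at_top" by simp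
  have *: "0 \<le> tail_tau M X eps T \<and> tail_tau M X eps T \<le> trunc_rho M X eps T / eps\<^sup>2" if "0 < T" for T
    using that eps trunc_sigma_nonneg[OF that, of eps]
    by (auto simp: trunc_rho_eq[OF that eps] tail_tau_nonneg field_simps)
  show "((\<lambda>T. tail_tau M X eps T) \<longlongrightarrow> 0) at_top"
    by (rule tendsto_zero_at_top_sandwich[OF lim]) (use * in auto)
next
  assume tau: "((\<lambda>T. tail_tau M X eps T) \<longlongrightarrow> 0) at_top"
  have "((\<lambda>T. trunc_rho M X eps T / (2 * eps\<^sup>2)) \<longlongrightarrow> 0) at_top"
  proof (rule tendsto_zero_at_top_by_bound)
    fix e :: real assume e: "0 < e"
    from order_tendstoD(2)[OF tau e] obtain A0 where A0: "\<And>t. A0 \<le> t \<Longrightarrow> tail_tau M X eps t < e"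
      by (auto simp: eventually_at_top_linorder)
    define A where "A = max A0 1"
    have A: "0 < A" "\<And>t. A \<le> t \<Longrightarrow> tail_tau M X eps t < e" using A0 by (auto simp: A_def)
    have "0 \<le> trunc_rho M X eps T / (2 * eps\<^sup>2) \<and> trunc_rho M X eps T / (2 * eps\<^sup>2) \<le> e + A\<^sup>2 / T"
      if T: "0 < T" for T
    proof
      show "0 \<le> trunc_rho M X eps T / (2 * eps\<^sup>2)"
        using trunc_rho_nonneg[OF T] by simp
      note I = has_bochner_integral_tail_tau[OF eps T]
      have "T * trunc_rho M X eps T / (2 * eps\<^sup>2)
          = (LINT t|lborel. indicator {0<..<T} t * tail_tau M X eps t)"
        using I by (simp add: has_bochner_integral_iff)
      \<comment> \<open>Beyond \<open>A\<close> the integrand is below \<open>e\<close>; before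
        \<open>A\<close> it is at most \<open>t\<close>, hence at most \<open>A\<close>, which
        contributes \<open>A\<^sup>2\<close> in total.\<close>
      also have "\<dots> \<le> (LINT t|lborel. indicator {0<..<T} t * e + indicator {0<..<A} t * A)"
      proof (rule integral_mono)
        fix t
        have "tail_tau M X eps t \<le> t" if "0 < t"
          using that by (simp add: tail_tau_def mult_left_le)
        then show "indicator {0<..<T} t * tail_tau M X eps t
            \<le> indicator {0<..<T} t * e + indicator {0<..<A} t * A"
          using A(1) A(2)[of t] e by (auto simp: indicator_def not_less)
      qed (use I T A in \<open>auto simp: has_bochner_integral_iff\<close>)
      also have "\<dots> = T * e + A\<^sup>2"
        using T A by (subst Bochner_Integration.integral_add) (auto simp: power2_eq_square)
      finally show "trunc_rho M X eps T / (2 * eps\<^sup>2) \<le> e + A\<^sup>2 / T"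
        using T eps by (simp add: field_simps)
    qed
    then show "\<exists>A C. \<forall>T>0. A \<le> T \<longrightarrow> 0 \<le> trunc_rho M X eps T / (2 * eps\<^sup>2) \<and>
        trunc_rho M X eps T / (2 * eps\<^sup>2) \<le> e + C / T"
      by blast
  qed
  from tendsto_mult_right_zero[OF this, of "2 * eps\<^sup>2"] show "((\<lambda>T. trunc_rho M X eps T) \<longlongrightarrow> 0) at_top"
    using eps by simp
qed

text \<open>Here \<open>trunc_rho\<close> at \<open>T\<close> equals \<open>2 * T\<close> times the
  integral of \<open>trunc_sigma / t\<^sup>2\<close> beyond \<open>T\<close>, so a bound valid for
  all large \<open>t\<close> passes to it directly.\<close>

lemma trunc_sigma_tendsto_iff_trunc_rho:
  "((\<lambda>T. trunc_sigma M X eps T) \<longlongrightarrow> 0) at_top \<longleftrightarrow> ((\<lambda>T. trunc_rho M X eps T) \<longlongrightarrow> 0) at_top"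
proof
  assume rho: "((\<lambda>T. trunc_rho M X eps T) \<longlongrightarrow> 0) at_top"
  have *: "0 \<le> trunc_sigma M X eps T \<and> trunc_sigma M X eps T \<le> trunc_rho M X eps T" if "0 < T" for T
    using that eps trunc_sigma_nonneg[OF that, of eps] tail_tau_nonneg[OF that, of eps]
    by (auto simp: trunc_rho_eq[OF that eps])
  show "((\<lambda>T. trunc_sigma M X eps T) \<longlongrightarrow> 0) at_top"
    by (rule tendsto_zero_at_top_sandwich[OF rho]) (use * in auto)
next
  assume sigma: "((\<lambda>T. trunc_sigma M X eps T) \<longlongrightarrow> 0) at_top"
  show "((\<lambda>T. trunc_rho M X eps T) \<longlongrightarrow> 0) at_top"
  proof (rule tendsto_zero_at_top_by_bound)
    fix e :: real assume e: "0 < e"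
    from order_tendstoD(2)[OF sigma, of "e / 2"] e
    obtain A where A: "\<And>t. A \<le> t \<Longrightarrow> trunc_sigma M X eps t < e / 2"
      by (auto simp: eventually_at_top_linorder)
    \<comment> \<open>No initial segment enters, hence the slack \<open>0\<close>. The bound
      \<open>e / 2\<close> on \<open>trunc_sigma\<close> integrates to \<open>e / (2 * T)\<close>,
      and the factor \<open>2 * T\<close> restores \<open>e\<close>.\<close>
    have "0 \<le> trunc_rho M X eps T \<and> trunc_rho M X eps T \<le> e + 0 / T" if T: "0 < T" "A \<le> T" for T
    proof
      show "0 \<le> trunc_rho M X eps T" using T by (simp add: trunc_rho_nonneg)
      note I = has_bochner_integral_trunc_sigma[OF eps T(1)]
      note J = has_bochner_integral_mult_right[OF has_bochner_integral_inverse_square_tail[OF T(1)], of "e / 2"]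
      have "trunc_rho M X eps T / (2 * T)
          = (LINT t|lborel. indicator {T<..} t * (trunc_sigma M X eps t / t\<^sup>2))"
        using I by (simp add: has_bochner_integral_iff)
      also have "\<dots> \<le> (LINT t|lborel. e / 2 * (indicator {T<..} t * (1 / t\<^sup>2)))"
      proof (rule integral_mono)
        show "indicator {T<..} t * (trunc_sigma M X eps t / t\<^sup>2) \<le> e / 2 * (indicator {T<..} t * (1 / t\<^sup>2))" for t
          using A[of t] T divide_right_mono[of "trunc_sigma M X eps t" "e / 2" "t\<^sup>2"]
          by (auto simp: indicator_def)
      qed (use I J e in \<open>simp_all add: has_bochner_integral_iff\<close>)
      also have "\<dots> = e / 2 * (1 / T)"
        using J e by (simp add: has_bochner_integral_iff)
      finally show "trunc_rho M X eps T \<le> e + 0 / T"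
        using T by (simp add: field_simps)
    qed
    then show "\<exists>A C. \<forall>T>0. A \<le> T \<longrightarrow> 0 \<le> trunc_rho M X eps T \<and> trunc_rho M X eps T \<le> e + C / T"
      by blast
  qed
qed

lemma trunc_var_tendsto_iff_trunc_rho:
  "((\<lambda>T. trunc_var M X eps T) \<longlongrightarrow> 0) at_top \<longleftrightarrow> ((\<lambda>T. trunc_rho M X eps T) \<longlongrightarrow> 0) at_top"
proof
  assume rho: "((\<lambda>T. trunc_rho M X eps T) \<longlongrightarrow> 0) at_top"
  then have sigma: "((\<lambda>T. trunc_sigma M X eps T) \<longlongrightarrow> 0) at_top"
    by (simp only: trunc_sigma_tendsto_iff_trunc_rho)
  show "((\<lambda>T. trunc_var M X eps T) \<longlongrightarrow> 0) at_top"
    by (rule tendsto_zero_at_top_sandwich[OF sigma trunc_var_nonneg trunc_var_le_sigma])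
next
  assume var: "((\<lambda>T. trunc_var M X eps T) \<longlongrightarrow> 0) at_top"
  obtain A where A: "\<And>T. 0 < T \<Longrightarrow> trunc_sigma M X eps T \<le> 5 * trunc_var M X eps T + A / T"
    using trunc_sigma_le_var by metis
  have "((\<lambda>T. A / T) \<longlongrightarrow> 0) at_top" by real_asymp
  from tendsto_add[OF tendsto_mult_right_zero[OF var, of 5] this]
  have lim: "((\<lambda>T. 5 * trunc_var M X eps T + A / T) \<longlongrightarrow> 0) at_top" by simp
  have "((\<lambda>T. trunc_sigma M X eps T) \<longlongrightarrow> 0) at_top"
    by (rule tendsto_zero_at_top_sandwich[OF lim trunc_sigma_nonneg A])
  then show "((\<lambda>T. trunc_rho M X eps T) \<longlongrightarrow> 0) at_top"
    by (simp only: trunc_sigma_tendsto_iff_trunc_rho)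
qed

lemma average_tail_tau_tendsto_iff_trunc_rho:
  "((\<lambda>T. (1 / T) * (LBINT t=ereal 0..ereal T. tail_tau M X eps t)) \<longlongrightarrow> 0) at_top
    \<longleftrightarrow> ((\<lambda>T. trunc_rho M X eps T) \<longlongrightarrow> 0) at_top"
proof -
  have "((\<lambda>T. (1 / T) * (LBINT t=ereal 0..ereal T. tail_tau M X eps t)) \<longlongrightarrow> 0) at_top
    \<longleftrightarrow> ((\<lambda>T. trunc_rho M X eps T / (2 * eps\<^sup>2)) \<longlongrightarrow> 0) at_top"
    by (intro filterlim_cong refl eventually_mono[OF eventually_gt_at_top[of 0]] average_tail_tau)
  also have "\<dots> \<longleftrightarrow> ((\<lambda>T. trunc_rho M X eps T) \<longlongrightarrow> 0) at_top"
    using eps tendsto_divide_zero[of "\<lambda>T. trunc_rho M X eps T" at_top "2 * eps\<^sup>2"]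
      tendsto_mult_left_zero[of "\<lambda>T. trunc_rho M X eps T / (2 * eps\<^sup>2)" at_top "2 * eps\<^sup>2"]
    by auto
  finally show ?thesis .
qed

lemma tail_integral_trunc_sigma_tendsto_iff_trunc_rho:
  "((\<lambda>T. T * (LBINT t=ereal T..\<infinity>. trunc_sigma M X eps t / t\<^sup>2)) \<longlongrightarrow> 0) at_top
    \<longleftrightarrow> ((\<lambda>T. trunc_rho M X eps T) \<longlongrightarrow> 0) at_top"
proof -
  have "((\<lambda>T. T * (LBINT t=ereal T..\<infinity>. trunc_sigma M X eps t / t\<^sup>2)) \<longlongrightarrow> 0) at_top
    \<longleftrightarrow> ((\<lambda>T. trunc_rho M X eps T / 2) \<longlongrightarrow> 0) at_top"
    by (intro filterlim_cong refl eventually_mono[OF eventually_gt_at_top[of 0]] tail_integral_trunc_sigma)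
  also have "\<dots> \<longleftrightarrow> ((\<lambda>T. trunc_rho M X eps T) \<longlongrightarrow> 0) at_top"
    using tendsto_divide_zero[of "\<lambda>T. trunc_rho M X eps T" at_top 2]
      tendsto_mult_left_zero[of "\<lambda>T. trunc_rho M X eps T / 2" at_top 2]
    by auto
  finally show ?thesis .
qed

text \<open>The pointwise comparison of variance and second moment is integrated against
  \<open>1 / t\<^sup>2\<close> beyond \<open>T\<close>; the error \<open>A / t\<close> becomes
  \<open>A / (2 * T\<^sup>2)\<close> and, after multiplication by \<open>T\<close>, the last
  term.\<close>

lemma tail_integral_trunc_var_bounds:
  assumes T: "0 < T"
    and A: "\<And>t. 0 < t \<Longrightarrow> trunc_sigma M X eps t \<le> 5 * trunc_var M X eps t + A / t"
  defines "V \<equiv> T * (LBINT t=ereal T..\<infinity>. trunc_var M X eps t / t\<^sup>2)"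
  shows "0 \<le> V" "V \<le> trunc_rho M X eps T / 2" "trunc_rho M X eps T / 2 \<le> 5 * V + A / (2 * T)"
proof -
  let ?v = "\<lambda>t. indicator {T<..} t * (trunc_var M X eps t / t\<^sup>2)"
  let ?s = "\<lambda>t. indicator {T<..} t * (trunc_sigma M X eps t / t\<^sup>2)"
  let ?c = "\<lambda>t. A * (indicator {T<..} t * (1 / t ^ 3))"
  note I = has_bochner_integral_trunc_sigma[OF eps T]
  have C: "has_bochner_integral lborel ?c (A * (1 / (2 * T\<^sup>2)))"
    using has_bochner_integral_inverse_cube_tail[OF T] by (rule has_bochner_integral_mult_right)
  have V: "V = T * (LINT t|lborel. ?v t)"
    by (simp add: V_def interval_integral_to_infinity_eq set_lebesgue_integral_def)
  have v0: "0 \<le> ?v t" for t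
    using T by (auto simp: indicator_def trunc_var_nonneg)
  have vs: "?v t \<le> ?s t" for t
    using T by (auto simp: indicator_def trunc_var_le_sigma divide_right_mono)
  have sv: "?s t \<le> 5 * ?v t + ?c t" for t
  proof (cases "T < t")
    case True
    then have "trunc_sigma M X eps t / t\<^sup>2 \<le> (5 * trunc_var M X eps t + A / t) / t\<^sup>2"
      using A[of t] T by (intro divide_right_mono) auto
    also have "\<dots> = 5 * (trunc_var M X eps t / t\<^sup>2) + A * (1 / t ^ 3)"
      by (simp add: add_divide_distrib power2_eq_square power3_eq_cube)
    finally show ?thesis using True by simp
  qed simp
  have ints: "integrable lborel ?s" using I by (simp add: has_bochner_integral_iff)
  \<comment> \<open>Domination by the second moment, whose integrability Fubini has
    supplied.\<close>
  have intv: "integrable lborel ?v"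
    by (rule Bochner_Integration.integrable_bound[OF ints borel_measurable_trunc_var_tail[OF T]])
       (intro AE_I2, simp only: real_norm_def abs_of_nonneg[OF v0] order_trans[OF vs abs_ge_self])
  have int5v: "integrable lborel (\<lambda>t. 5 * ?v t)"
    by (rule integrable_mult_right) (rule intv)
  have intc: "integrable lborel ?c" using C by (simp only: has_bochner_integral_iff)
  show "0 \<le> V"
    unfolding V by (intro mult_nonneg_nonneg less_imp_le[OF T] integral_nonneg_AE AE_I2 v0)
  have "T * (LINT t|lborel. ?v t) \<le> T * (LINT t|lborel. ?s t)"
    using T by (intro mult_left_mono integral_mono ints intv vs) auto
  also have "\<dots> = trunc_rho M X eps T / 2"
    using I T by (simp add: has_bochner_integral_iff)
  finally show "V \<le> trunc_rho M X eps T / 2" unfolding V .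
  have "(LINT t|lborel. ?s t) \<le> (LINT t|lborel. 5 * ?v t + ?c t)"
    by (rule integral_mono[OF ints Bochner_Integration.integrable_add[OF int5v intc] sv])
  also have "\<dots> = 5 * (LINT t|lborel. ?v t) + (LINT t|lborel. ?c t)"
    by (simp only: Bochner_Integration.integral_add[OF int5v intc] integral_mult_right_zero)
  also have "(LINT t|lborel. ?c t) = A * (1 / (2 * T\<^sup>2))"
    using C by (simp only: has_bochner_integral_iff)
  also have "(LINT t|lborel. ?s t) = trunc_rho M X eps T / (2 * T)"
    using I by (simp only: has_bochner_integral_iff)
  finally have "T * (trunc_rho M X eps T / (2 * T)) \<le> T * (5 * (LINT t|lborel. ?v t) + A * (1 / (2 * T\<^sup>2)))"
    using T by (intro mult_left_mono) auto
  then show "trunc_rho M X eps T / 2 \<le> 5 * V + A / (2 * T)"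
    unfolding V using T by (simp add: distrib_left power2_eq_square)
qed

lemma tail_integral_trunc_var_tendsto_iff_trunc_rho:
  "((\<lambda>T. T * (LBINT t=ereal T..\<infinity>. trunc_var M X eps t / t\<^sup>2)) \<longlongrightarrow> 0) at_top
    \<longleftrightarrow> ((\<lambda>T. trunc_rho M X eps T) \<longlongrightarrow> 0) at_top" (is "(?V \<longlongrightarrow> 0) at_top \<longleftrightarrow> _")
proof -
  obtain A where A: "\<And>T. 0 < T \<Longrightarrow> trunc_sigma M X eps T \<le> 5 * trunc_var M X eps T + A / T"
    using trunc_sigma_le_var by metis
  note bounds = tail_integral_trunc_var_bounds[OF _ A]
  show ?thesis
  proof
    assume rho: "((\<lambda>T. trunc_rho M X eps T) \<longlongrightarrow> 0) at_top"
    have lim: "((\<lambda>T. trunc_rho M X eps T / 2) \<longlongrightarrow> 0) at_top"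
      by (rule tendsto_divide_zero[OF rho])
    show "(?V \<longlongrightarrow> 0) at_top"
      by (rule tendsto_zero_at_top_sandwich[OF lim bounds(1,2)])
  next
    assume V: "(?V \<longlongrightarrow> 0) at_top"
    have "((\<lambda>T. A / T) \<longlongrightarrow> 0) at_top" by real_asymp
    \<comment> \<open>The factor \<open>10\<close> comes from doubling the third bound.\<close>
    from tendsto_add[OF tendsto_mult_right_zero[OF V, of 10] this]
    have lim: "((\<lambda>T. 10 * ?V T + A / T) \<longlongrightarrow> 0) at_top" by simp
    have *: "trunc_rho M X eps T \<le> 10 * ?V T + A / T" if "0 < T" for T
      using bounds(3)[OF that] by simp
    show "((\<lambda>T. trunc_rho M X eps T) \<longlongrightarrow> 0) at_top"
      by (rule tendsto_zero_at_top_sandwich[OF lim trunc_rho_nonneg *])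
  qed
qed

end
end

section \<open>Second moments of independent sums, and probabilities of unions\<close>

text \<open>By induction: the cross term has expectation \<open>0\<close>, because the new centred
  variable is independent of the sum of the earlier ones. Integrability is carried through the same
  induction, since splitting the expectation depends on it.\<close>

lemma second_moment_sum_indep:
  fixes Z :: "'i \<Rightarrow> 'a \<Rightarrow> real"
  assumes "finite I" and "indep_vars (\<lambda>_. borel) Z I"
    and "\<And>i. i \<in> I \<Longrightarrow> integrable M (Z i)" and "\<And>i. i \<in> I \<Longrightarrow> integrable M (\<lambda>\<omega>. (Z i \<omega>)\<^sup>2)"
    and "\<And>i. i \<in> I \<Longrightarrow> expectation (Z i) = 0"
  shows "integrable M (\<lambda>\<omega>. (\<Sum>i\<in>I. Z i \<omega>)\<^sup>2)"
    and "expectation (\<lambda>\<omega>. (\<Sum>i\<in>I. Z i \<omega>)\<^sup>2) = (\<Sum>i\<in>I. expectation (\<lambda>\<omega>. (Z i \<omega>)\<^sup>2))"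
proof -
  have "integrable M (\<lambda>\<omega>. (\<Sum>i\<in>I. Z i \<omega>)\<^sup>2) \<and>
    expectation (\<lambda>\<omega>. (\<Sum>i\<in>I. Z i \<omega>)\<^sup>2) = (\<Sum>i\<in>I. expectation (\<lambda>\<omega>. (Z i \<omega>)\<^sup>2))"
    using assms
  proof (induction I rule: finite_induct)
    case (insert j J)
    let ?S = "\<lambda>\<omega>. \<Sum>i\<in>J. Z i \<omega>"
    have IH: "integrable M (\<lambda>\<omega>. (?S \<omega>)\<^sup>2)"
      "expectation (\<lambda>\<omega>. (?S \<omega>)\<^sup>2) = (\<Sum>i\<in>J. expectation (\<lambda>\<omega>. (Z i \<omega>)\<^sup>2))"
      using insert.IH indep_vars_subset[OF insert.prems(1), of J] insert.prems(2-4) by auto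
    have ind: "indep_var borel (Z j) borel ?S"
      using insert by (intro indep_vars_sum) auto
    have intZ: "integrable M (Z j)" "integrable M (\<lambda>\<omega>. (Z j \<omega>)\<^sup>2)" and intS: "integrable M ?S"
      using insert.prems by auto
    have cross: "integrable M (\<lambda>\<omega>. Z j \<omega> * ?S \<omega>)" "expectation (\<lambda>\<omega>. Z j \<omega> * ?S \<omega>) = 0"
      using indep_var_integrable[OF ind intZ(1) intS] indep_var_lebesgue_integral[OF ind intZ(1) intS]
        insert.prems(4)[of j] by simp_all
    have eq: "(\<Sum>i\<in>insert j J. Z i \<omega>)\<^sup>2 = (Z j \<omega>)\<^sup>2 + (?S \<omega>)\<^sup>2 + 2 * (Z j \<omega> * ?S \<omega>)" for \<omega>
      using insert.hyps by (simp add: power2_sum)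
    show ?case
      unfolding eq using intZ IH cross insert.hyps by simp
  qed simp
  then show "integrable M (\<lambda>\<omega>. (\<Sum>i\<in>I. Z i \<omega>)\<^sup>2)"
    "expectation (\<lambda>\<omega>. (\<Sum>i\<in>I. Z i \<omega>)\<^sup>2) = (\<Sum>i\<in>I. expectation (\<lambda>\<omega>. (Z i \<omega>)\<^sup>2))"
    by auto
qed

text \<open>A Bonferroni inequality, with \<open>m\<^sup>2\<close> in place of the binomial coefficient.\<close>
lemma prob_UN_ge_bonferroni:
  assumes "\<And>k. k \<in> {1..m} \<Longrightarrow> A k \<in> events"
    and "\<And>k. k \<in> {1..m} \<Longrightarrow> a \<le> prob (A k)"
    and "\<And>j k. j \<in> {1..m} \<Longrightarrow> k \<in> {1..m} \<Longrightarrow> j \<noteq> k \<Longrightarrow> prob (A j \<inter> A k) \<le> q"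
    and "0 \<le> q"
  shows "real m * a - (real m)\<^sup>2 * q \<le> prob (\<Union>k\<in>{1..m}. A k)"
  using assms(1-3)
proof (induction m)
  case (Suc m)
  let ?U = "\<Union>k\<in>{1..m}. A k"
  have U: "?U \<in> events" and A: "A (Suc m) \<in> events" using Suc.prems(1) by auto
  have IH: "real m * a - (real m)\<^sup>2 * q \<le> prob ?U"
    using Suc.prems by (intro Suc.IH) auto
  have "prob (\<Union>k\<in>{1..m}. A k \<inter> A (Suc m)) \<le> (\<Sum>k\<in>{1..m}. prob (A k \<inter> A (Suc m)))"
    using Suc.prems(1) by (intro finite_measure_subadditive_finite) auto
  also have "\<dots> \<le> (\<Sum>k\<in>{1..m}. q)"
    using Suc.prems(3) by (intro sum_mono) auto
  finally have "prob (?U \<inter> A (Suc m)) \<le> real m * q" by simp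
  moreover have "prob (?U \<union> A (Suc m)) = prob ?U + prob (A (Suc m)) - prob (?U \<inter> A (Suc m))"
    using measure_Un3[of ?U M "A (Suc m)"] U A by (simp add: fmeasurable_eq_sets)
  moreover have "a \<le> prob (A (Suc m))" using Suc.prems(2) by simp
  moreover have "prob (\<Union>k\<in>{1..Suc m}. A k) = prob (?U \<union> A (Suc m))"
    by (simp add: atLeastAtMostSuc_conv Un_commute)
  \<comment> \<open>The square grows by \<open>2 * m + 1\<close>, which more than covers the
    \<open>m\<close> overlaps with the new event.\<close>
  moreover have "(real (Suc m))\<^sup>2 * q = (real m)\<^sup>2 * q + 2 * (real m * q) + q"
    by (simp add: power2_eq_square algebra_simps)
  moreover have "0 \<le> real m * q" using \<open>0 \<le> q\<close> by simp
  moreover have "real (Suc m) * a = real m * a + a" by (simp add: algebra_simps)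
  ultimately show ?case using IH \<open>0 \<le> q\<close> by linarith
qed simp

section \<open>Independent identically distributed sequences: truncation and the weak law\<close>

context
  fixes h :: "nat \<Rightarrow> 'a \<Rightarrow> real"
  assumes indep: "indep_vars (\<lambda>_. borel) h {1..}"
    and ident: "\<And>n. 1 \<le> n \<Longrightarrow> distr M borel (h n) = distr M borel (h 1)"
  notes [simp del] = One_nat_def
begin

lemma iid_measurable: "1 \<le> n \<Longrightarrow> random_variable borel (h n)"
  using indep by (auto simp: indep_vars_def)

lemma iid_prob_eq:
  assumes "1 \<le> n" "Measurable.pred borel P"
  shows "prob {\<omega> \<in> space M. P (h n \<omega>)} = prob {\<omega> \<in> space M. P (h 1 \<omega>)}"
proof -
  have B: "{x. P x} \<in> sets borel" using assms(2) by (simp add: pred_def)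
  have "prob {\<omega> \<in> space M. P (h k \<omega>)} = measure (distr M borel (h k)) {x. P x}" if "1 \<le> k" for k
    using measure_distr[OF iid_measurable[OF that] B]
    by (auto intro!: arg_cong[where f = prob])
  from this[OF assms(1)] this[OF order_refl] show ?thesis by (simp only: ident[OF assms(1)])
qed

lemma iid_expectation_eq:
  fixes g :: "real \<Rightarrow> real"
  assumes "1 \<le> n" and [measurable]: "g \<in> borel_measurable borel"
  shows "expectation (\<lambda>\<omega>. g (h n \<omega>)) = expectation (\<lambda>\<omega>. g (h 1 \<omega>))"
  using integral_distr[OF iid_measurable[OF assms(1)] assms(2)]
    integral_distr[OF iid_measurable[OF order_refl] assms(2)]
  by (simp only: ident[OF assms(1)])

text \<open>The first term is a union bound for the event that truncation at \<open>N\<close> alters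
  some summand; the second is Chebyshev's inequality for the centred truncated sum.\<close>

lemma avg_dev_prob_trunc_mean_le:
  assumes "1 \<le> N" "0 < eps"
  shows "avg_dev_prob M h N (trunc_mean M (h 1) 1 (real N)) eps
    \<le> tail_tau M (h 1) 1 (real N) + trunc_var M (h 1) 1 (real N) / eps\<^sup>2"
proof -
  have meas[measurable]: "random_variable borel (h i)" if "i \<in> {1..N}" for i
    using iid_measurable that by simp
  have meas1: "random_variable borel (h 1)" by (rule iid_measurable) simp
  define m where "m = trunc_mean M (h 1) 1 (real N)"
  \<comment> \<open>Truncation is written as a function on the reals, so that independence and
    equality in law pass to the truncated variables by composition.\<close>
  define g where "g x = (if \<bar>x\<bar> \<le> real N then x else 0)" for x :: real
  have g[measurable]: "g \<in> borel_measurable borel" unfolding g_def by measurable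
  have gb: "\<bar>g x\<bar> \<le> real N" for x by (simp add: g_def)
  have ig: "integrable M (\<lambda>\<omega>. g (h i \<omega>))" if "i \<in> {1..N}" for i
    using that by (intro integrable_const_bound[where B = "real N"]) (auto simp: gb)
  have ig2: "integrable M (\<lambda>\<omega>. (g (h i \<omega>) - m)\<^sup>2)" if "i \<in> {1..N}" for i
  proof (rule integrable_const_bound[where B = "(real N + \<bar>m\<bar>)\<^sup>2"])
    have "(g x - m)\<^sup>2 \<le> (real N + \<bar>m\<bar>)\<^sup>2" for x
      using power_mono[of "\<bar>g x - m\<bar>" "real N + \<bar>m\<bar>" 2] gb[of x] by simp
    then show "AE \<omega> in M. norm ((g (h i \<omega>) - m)\<^sup>2) \<le> (real N + \<bar>m\<bar>)\<^sup>2" by simp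
  qed (use that in measurable)
  have trunc_eq: "h 1 \<omega> * indicator {\<omega> \<in> space M. \<bar>h 1 \<omega>\<bar> \<le> 1 * real N} \<omega> = g (h 1 \<omega>)"
    if "\<omega> \<in> space M" for \<omega>
    using that by (simp add: g_def indicator_def)
  have m_eq: "m = expectation (\<lambda>\<omega>. g (h 1 \<omega>))"
    unfolding m_def trunc_mean_def by (rule Bochner_Integration.integral_cong) (simp_all only: trunc_eq)
  have v_eq: "trunc_var M (h 1) 1 (real N) = expectation (\<lambda>\<omega>. (g (h 1 \<omega>) - m)\<^sup>2) / real N"
    unfolding trunc_var_def m_def[symmetric]
    by (simp only: trunc_eq cong: Bochner_Integration.integral_cong) simp
  define Z where "Z i \<omega> = g (h i \<omega>) - m" for i \<omega>
  define S where "S \<omega> = (\<Sum>i\<in>{1..N}. Z i \<omega>)" for \<omega>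
  have ind: "indep_vars (\<lambda>_. borel) Z {1..N}"
    unfolding Z_def
    by (rule indep_vars_compose2[where Y = "\<lambda>_ x. g x - m" and X = h])
       (auto intro: indep_vars_subset[OF indep])
  have intZ: "integrable M (Z i)" "integrable M (\<lambda>\<omega>. (Z i \<omega>)\<^sup>2)" if "i \<in> {1..N}" for i
    using ig ig2 that unfolding Z_def by auto
  have eZ: "expectation (Z i) = 0" if "i \<in> {1..N}" for i
    using ig[OF that] iid_expectation_eq[OF _ g, of i] that unfolding Z_def m_eq
    by (simp add: prob_space)
  \<comment> \<open>The factor \<open>real N\<close> undoes the normalisation by
    \<open>1 / t\<close> in \<open>trunc_var\<close>. Summing over the indices gives a second
    \<open>real N\<close>, and both cancel against \<open>(eps * real N)\<^sup>2\<close>.\<close>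
  have eZ2: "expectation (\<lambda>\<omega>. (Z i \<omega>)\<^sup>2) = real N * trunc_var M (h 1) 1 (real N)" if "i \<in> {1..N}" for i
    using iid_expectation_eq[of i "\<lambda>x. (g x - m)\<^sup>2"] that assms unfolding Z_def v_eq by simp
  have intS: "integrable M S" and eS: "expectation S = 0"
    using intZ eZ unfolding S_def by auto
  have [measurable]: "random_variable borel S" using intS by simp
  note sm = second_moment_sum_indep[OF _ ind intZ eZ, folded S_def]
  have "prob {\<omega> \<in> space M. \<bar>S \<omega> - expectation S\<bar> \<ge> eps * real N} \<le> variance S / (eps * real N)\<^sup>2"
    using sm(1) assms by (intro Chebyshev_inequality) auto
  also have "variance S = real N * (real N * trunc_var M (h 1) 1 (real N))"
    using sm(2) by (simp add: eS eZ2)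
  also have "\<dots> / (eps * real N)\<^sup>2 = trunc_var M (h 1) 1 (real N) / eps\<^sup>2"
    using assms by (simp add: power2_eq_square)
  finally have cheb: "prob {\<omega> \<in> space M. \<bar>S \<omega>\<bar> \<ge> eps * real N} \<le> trunc_var M (h 1) 1 (real N) / eps\<^sup>2"
    by (simp add: eS)
  \<comment> \<open>Off \<open>?U\<close> the truncation changes nothing, so \<open>S\<close> is the
    original sum minus \<open>real N * m\<close>.\<close>
  let ?U = "\<Union>i\<in>{1..N}. {\<omega> \<in> space M. \<bar>h i \<omega>\<bar> > real N}"
  have evU: "?U \<in> events" by (intro sets.finite_UN) (simp, measurable)
  have evS: "{\<omega> \<in> space M. \<bar>S \<omega>\<bar> \<ge> eps * real N} \<in> events" by measurable
  have "prob ?U \<le> (\<Sum>i\<in>{1..N}. prob {\<omega> \<in> space M. \<bar>h i \<omega>\<bar> > real N})"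
    by (rule finite_measure_subadditive_finite) auto
  also have "\<dots> = (\<Sum>i\<in>{1..N}. prob {\<omega> \<in> space M. \<bar>h 1 \<omega>\<bar> > real N})"
    by (intro sum.cong refl iid_prob_eq[where P = "\<lambda>x. \<bar>x\<bar> > real N"]) auto
  also have "\<dots> = tail_tau M (h 1) 1 (real N)"
    by (simp add: tail_tau_def)
  finally have U: "prob ?U \<le> tail_tau M (h 1) 1 (real N)" .
  have "avg_dev_prob M h N m eps \<le> prob (?U \<union> {\<omega> \<in> space M. \<bar>S \<omega>\<bar> \<ge> eps * real N})"
    unfolding avg_dev_prob_def
  proof (rule finite_measure_mono)
    show "{\<omega> \<in> space M. \<bar>(1 / real N) * (\<Sum>n\<in>{1..N}. h n \<omega>) - m\<bar> > eps}
      \<subseteq> ?U \<union> {\<omega> \<in> space M. \<bar>S \<omega>\<bar> \<ge> eps * real N}"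
    proof
      fix \<omega> assume w: "\<omega> \<in> {\<omega> \<in> space M. \<bar>(1 / real N) * (\<Sum>n\<in>{1..N}. h n \<omega>) - m\<bar> > eps}"
      show "\<omega> \<in> ?U \<union> {\<omega> \<in> space M. \<bar>S \<omega>\<bar> \<ge> eps * real N}"
      proof (cases "\<omega> \<in> ?U")
        case False
        then have "g (h i \<omega>) = h i \<omega>" if "i \<in> {1..N}" for i
          using that w by (auto simp: g_def not_less)
        then have "S \<omega> = (\<Sum>n\<in>{1..N}. h n \<omega>) - real N * m"
          by (simp add: S_def Z_def sum_subtractf)
        then have "S \<omega> = ((1 / real N) * (\<Sum>n\<in>{1..N}. h n \<omega>) - m) * real N"
          using assms by (simp add: left_diff_distrib)
        then have "\<bar>S \<omega>\<bar> = \<bar>(1 / real N) * (\<Sum>n\<in>{1..N}. h n \<omega>) - m\<bar> * real N"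
          by (simp add: abs_mult)
        also have "\<dots> \<ge> eps * real N" using w by (intro mult_right_mono) auto
        finally show ?thesis using w by auto
      qed simp
    qed
  qed (use evU evS in auto)
  also have "\<dots> \<le> prob ?U + prob {\<omega> \<in> space M. \<bar>S \<omega>\<bar> \<ge> eps * real N}"
    using evU evS by (rule measure_Un_le)
  finally show ?thesis using U cheb unfolding m_def by linarith
qed

section \<open>Necessity: large deviations of one summand force deviations of the sum\<close>

text \<open>A single summand exceeding \<open>3 r\<close> while the remaining ones stay within \<open>2 r\<close> of \<open>c\<close> pushes the
  whole sum more than \<open>r\<close> away from \<open>c\<close>; by independence and the Bonferroni inequality this happens
  with probability comparable to the expected number of such summands.\<close>
lemma prob_sum_deviation_ge:
  fixes c r :: real
  assumes "m \<le> N" "0 < r"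
  defines "b \<equiv> prob {\<omega> \<in> space M. \<bar>(\<Sum>n\<in>{1..N}. h n \<omega>) - c\<bar> > r}"
    and "p \<equiv> prob {\<omega> \<in> space M. \<bar>h 1 \<omega>\<bar> > 3 * r}"
    and "p' \<equiv> prob {\<omega> \<in> space M. \<bar>h 1 \<omega>\<bar> > r}"
  shows "real m * (p * (1 - b - p')) - (real m)\<^sup>2 * p\<^sup>2 \<le> b"
proof -
  have meas[measurable]: "random_variable borel (h i)" if "i \<in> {1..N}" for i
    using iid_measurable that by simp
  define E where "E k = {\<omega> \<in> space M. \<bar>h k \<omega>\<bar> > 3 * r}" for k
  \<comment> \<open>Leaving out the index \<open>k\<close> makes the remainder independent of
    \<open>h k\<close>.\<close>
  define R where "R k \<omega> = (\<Sum>n\<in>{1..N} - {k}. h n \<omega>)" for k \<omega>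
  define G where "G k = {\<omega> \<in> space M. \<bar>R k \<omega> - c\<bar> \<le> 2 * r}" for k
  have [measurable]: "random_variable borel (R k)" for k
    unfolding R_def by (intro borel_measurable_sum) auto
  have evE: "E k \<in> events" if "k \<in> {1..N}" for k
    using meas[OF that] unfolding E_def by measurable
  have evG: "G k \<in> events" for k unfolding G_def by measurable
  let ?B = "{\<omega> \<in> space M. \<bar>(\<Sum>n\<in>{1..N}. h n \<omega>) - c\<bar> > r}"
  have evB: "?B \<in> events" by measurable
  have split: "(\<Sum>n\<in>{1..N}. h n \<omega>) = h k \<omega> + R k \<omega>" if "k \<in> {1..N}" for k \<omega>
    using that unfolding R_def by (intro sum.remove) auto
  have pE: "prob (E k) = p" if "k \<in> {1..N}" for k
    using iid_prob_eq[of k "\<lambda>x. \<bar>x\<bar> > 3 * r"] that unfolding E_def p_def by simp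
  \<comment> \<open>If the remainder is more than \<open>2 * r\<close> from \<open>c\<close>, then
    either the full sum is more than \<open>r\<close> from \<open>c\<close> or \<open>h k\<close>
    itself exceeds \<open>r\<close> in modulus. The quantity \<open>b\<close> to be bounded thus
    reappears on the other side.\<close>
  have pG: "1 - b - p' \<le> prob (G k)" if k: "k \<in> {1..N}" for k
  proof -
    have ev: "{\<omega> \<in> space M. \<bar>h k \<omega>\<bar> > r} \<in> events" using meas[OF k] by measurable
    have "prob (space M - G k) \<le> prob (?B \<union> {\<omega> \<in> space M. \<bar>h k \<omega>\<bar> > r})"
      using evB ev by (intro finite_measure_mono) (auto simp: G_def split[OF k])
    also have "\<dots> \<le> b + prob {\<omega> \<in> space M. \<bar>h k \<omega>\<bar> > r}"
      unfolding b_def by (rule measure_Un_le[OF evB ev])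
    also have "prob {\<omega> \<in> space M. \<bar>h k \<omega>\<bar> > r} = p'"
      using iid_prob_eq[of k "\<lambda>x. \<bar>x\<bar> > r"] k unfolding p'_def by simp
    finally show ?thesis using prob_compl[OF evG[of k]] by simp
  qed
  have pA: "p * (1 - b - p') \<le> prob (E k \<inter> G k)" if k: "k \<in> {1..N}" for k
  proof -
    have "indep_var borel (h k) borel (R k)"
      unfolding R_def using k by (intro indep_vars_sum indep_vars_subset[OF indep]) auto
    from indep_varD[OF this, of "{x. \<bar>x\<bar> > 3 * r}" "{x. \<bar>x - c\<bar> \<le> 2 * r}"]
    have "prob ((\<lambda>\<omega>. (h k \<omega>, R k \<omega>)) -` ({x. \<bar>x\<bar> > 3 * r} \<times> {x. \<bar>x - c\<bar> \<le> 2 * r}) \<inter> space M)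
      = prob (h k -` {x. \<bar>x\<bar> > 3 * r} \<inter> space M) * prob (R k -` {x. \<bar>x - c\<bar> \<le> 2 * r} \<inter> space M)"
      by simp
    also have "(\<lambda>\<omega>. (h k \<omega>, R k \<omega>)) -` ({x. \<bar>x\<bar> > 3 * r} \<times> {x. \<bar>x - c\<bar> \<le> 2 * r}) \<inter> space M = E k \<inter> G k"
      by (auto simp: E_def G_def)
    also have "h k -` {x. \<bar>x\<bar> > 3 * r} \<inter> space M = E k" by (auto simp: E_def)
    also have "R k -` {x. \<bar>x - c\<bar> \<le> 2 * r} \<inter> space M = G k" by (auto simp: G_def)
    finally have "prob (E k \<inter> G k) = p * prob (G k)" by (simp add: pE[OF k])
    moreover have "0 \<le> p" by (simp add: p_def)
    ultimately show ?thesis using pG[OF k] by (simp add: mult_left_mono)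
  qed
  have pEE: "prob (E j \<inter> E k) = p\<^sup>2" if jk: "j \<in> {1..N}" "k \<in> {1..N}" "j \<noteq> k" for j k
  proof -
    \<comment> \<open>Pairwise independence is read off as the case of a one-term sum.\<close>
    have "indep_var borel (h j) borel (\<lambda>\<omega>. \<Sum>n\<in>{k}. h n \<omega>)"
      using jk by (intro indep_vars_sum indep_vars_subset[OF indep]) auto
    then have "indep_var borel (h j) borel (h k)" by simp
    from indep_varD[OF this, of "{x. \<bar>x\<bar> > 3 * r}" "{x. \<bar>x\<bar> > 3 * r}"]
    have "prob ((\<lambda>\<omega>. (h j \<omega>, h k \<omega>)) -` ({x. \<bar>x\<bar> > 3 * r} \<times> {x. \<bar>x\<bar> > 3 * r}) \<inter> space M)
      = prob (h j -` {x. \<bar>x\<bar> > 3 * r} \<inter> space M) * prob (h k -` {x. \<bar>x\<bar> > 3 * r} \<inter> space M)"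
      by simp
    also have "(\<lambda>\<omega>. (h j \<omega>, h k \<omega>)) -` ({x. \<bar>x\<bar> > 3 * r} \<times> {x. \<bar>x\<bar> > 3 * r}) \<inter> space M = E j \<inter> E k"
      by (auto simp: E_def)
    also have "h j -` {x. \<bar>x\<bar> > 3 * r} \<inter> space M = E j" by (auto simp: E_def)
    also have "h k -` {x. \<bar>x\<bar> > 3 * r} \<inter> space M = E k" by (auto simp: E_def)
    finally show ?thesis by (simp add: pE[OF jk(1)] pE[OF jk(2)] power2_eq_square)
  qed
  have "real m * (p * (1 - b - p')) - (real m)\<^sup>2 * p\<^sup>2 \<le> prob (\<Union>k\<in>{1..m}. E k \<inter> G k)"
  proof (rule prob_UN_ge_bonferroni)
    fix j k assume jk: "j \<in> {1..m}" "k \<in> {1..m}" "j \<noteq> k"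
    then have "j \<in> {1..N}" "k \<in> {1..N}" using assms(1) by auto
    \<comment> \<open>The events \<open>G j\<close> and \<open>G k\<close> are dropped, as their
      remainders can share summands; independence of \<open>E j\<close> and \<open>E k\<close> alone
      yields \<open>p\<^sup>2\<close>.\<close>
    moreover from this have "prob (E j \<inter> G j \<inter> (E k \<inter> G k)) \<le> prob (E j \<inter> E k)"
      by (intro finite_measure_mono sets.Int evE) auto
    ultimately show "prob (E j \<inter> G j \<inter> (E k \<inter> G k)) \<le> p\<^sup>2"
      using jk(3) by (simp add: pEE)
  qed (use assms(1) in \<open>auto intro!: evE evG pA\<close>)
  also have "\<dots> \<le> prob ?B"
  proof (rule finite_measure_mono[OF _ evB], rule UN_least)
    fix k assume "k \<in> {1..m}"
    then have k: "k \<in> {1..N}" using assms(1) by auto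
    show "E k \<inter> G k \<subseteq> ?B"
    proof
      fix \<omega> assume "\<omega> \<in> E k \<inter> G k"
      then have "\<omega> \<in> space M" "\<bar>h k \<omega>\<bar> > 3 * r" "\<bar>R k \<omega> - c\<bar> \<le> 2 * r"
        by (auto simp: E_def G_def)
      moreover from this have "\<bar>h k \<omega> + R k \<omega> - c\<bar> > r" by linarith
      ultimately show "\<omega> \<in> ?B" by (simp only: split[OF k] mem_Collect_eq)
    qed
  qed
  finally show ?thesis unfolding b_def .
qed

text \<open>The Bonferroni bound is useful only while \<open>real m * p\<close> is at most
  \<open>1 / 2\<close>. Applying it to \<open>m \<le> N\<close> summands first excludes
  \<open>real N * p > 1 / 2\<close>, after which all \<open>N\<close> summands can be taken.\<close>

lemma tail_prob_le_deviation:
  fixes c r :: real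
  assumes r: "0 < r"
    and small: "prob {\<omega> \<in> space M. \<bar>(\<Sum>n\<in>{1..N}. h n \<omega>) - c\<bar> > r} < 1 / 16"
      "prob {\<omega> \<in> space M. \<bar>h 1 \<omega>\<bar> > r} < 1 / 8"
  shows "real N * prob {\<omega> \<in> space M. \<bar>h 1 \<omega>\<bar> > 3 * r}
    \<le> 4 * prob {\<omega> \<in> space M. \<bar>(\<Sum>n\<in>{1..N}. h n \<omega>) - c\<bar> > r}"
proof -
  define b where "b = prob {\<omega> \<in> space M. \<bar>(\<Sum>n\<in>{1..N}. h n \<omega>) - c\<bar> > r}"
  define p where "p = prob {\<omega> \<in> space M. \<bar>h 1 \<omega>\<bar> > 3 * r}"
  define p' where "p' = prob {\<omega> \<in> space M. \<bar>h 1 \<omega>\<bar> > r}"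
  have [measurable]: "random_variable borel (h 1)" by (rule iid_measurable) simp
  have p0: "0 \<le> p" by (simp add: p_def)
  have "p \<le> p'" unfolding p_def p'_def using r by (intro finite_measure_mono) auto
  with small have bounds: "b < 1 / 16" "p' < 1 / 8" "p < 1 / 8" by (simp_all add: b_def p'_def)
  have key: "real m * p / 4 \<le> b" if "m \<le> N" "real m * p \<le> 1 / 2" for m
  proof -
    \<comment> \<open>The bracket is at least
      \<open>1 - 1 / 16 - 1 / 8 - 1 / 2 = 5 / 16\<close>.\<close>
    have "real m * p * (1 / 4) \<le> real m * p * ((1 - b - p') - real m * p)"
      using that p0 bounds by (intro mult_left_mono) auto
    also have "\<dots> = real m * (p * (1 - b - p')) - (real m)\<^sup>2 * p\<^sup>2"
      by (simp add: algebra_simps power2_eq_square)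
    also have "\<dots> \<le> b"
      unfolding b_def p_def p'_def by (rule prob_sum_deviation_ge[OF that(1) r])
    finally show ?thesis by simp
  qed
  have "real N * p \<le> 1 / 2"
  proof (rule ccontr)
    assume N: "\<not> real N * p \<le> 1 / 2"
    then have p: "0 < p" using p0 by (cases "p = 0") auto
    \<comment> \<open>The largest number of summands with \<open>real m * p \<le> 1 / 2\<close>.
      Since \<open>p < 1 / 8\<close>, it gives \<open>real m * p > 3 / 8\<close>, so
      \<open>key\<close> forces \<open>b > 3 / 32\<close>, against
      \<open>b < 1 / 16\<close>.\<close>
    define m where "m = nat \<lfloor>1 / (2 * p)\<rfloor>"
    have m: "real m \<le> 1 / (2 * p)" "1 / (2 * p) < real m + 1"
      using p by (simp_all add: m_def)
    have "real m * p \<le> 1 / 2" "1 / 2 < real m * p + p"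
      using m p by (simp_all add: field_simps)
    moreover have "m \<le> N"
    proof -
      have "real m * p < real N * p" using \<open>real m * p \<le> 1 / 2\<close> N by linarith
      then show ?thesis using p by simp
    qed
    ultimately show False using key[of m] bounds by linarith
  qed
  from key[OF order_refl this] show ?thesis unfolding b_def p_def by linarith
qed

text \<open>Along integers, the tail bound is used with centre \<open>real N * d N\<close>;
  monotonicity of the tail probability then fills in real arguments at the cost of a factor
  \<open>2\<close>.\<close>

lemma tail_tau_tendsto_of_avg_dev_prob:
  assumes "\<And>eps. 0 < eps \<Longrightarrow> (\<lambda>N. avg_dev_prob M h N (d N) eps) \<longlonglongrightarrow> 0" and eps: "0 < eps"
  shows "((\<lambda>T. tail_tau M (h 1) eps T) \<longlongrightarrow> 0) at_top"
proof -
  have meas[measurable]: "random_variable borel (h 1)" by (rule iid_measurable) simp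
  \<comment> \<open>With \<open>r = e * real N\<close>, the threshold \<open>3 * r\<close> for a
    single summand becomes \<open>eps * real N\<close>.\<close>
  define e where "e = eps / 3"
  have e: "0 < e" "eps = 3 * e" using eps by (simp_all add: e_def)
  note lim = assms(1)[OF e(1)]
  have "filterlim (\<lambda>N. e * real N) at_top sequentially"
    using e(1) by real_asymp
  from filterlim_compose[OF prob_abs_gt_tendsto_0[OF meas] this]
  have "(\<lambda>N. prob {\<omega> \<in> space M. \<bar>h 1 \<omega>\<bar> > e * real N}) \<longlonglongrightarrow> 0" .
  then have "eventually (\<lambda>N. prob {\<omega> \<in> space M. \<bar>h 1 \<omega>\<bar> > e * real N} < 1 / 8) sequentially"
    by (rule order_tendstoD) simp
  moreover have "eventually (\<lambda>N. avg_dev_prob M h N (d N) e < 1 / 16) sequentially"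
    using lim by (rule order_tendstoD) simp
  ultimately have ev: "eventually (\<lambda>N. tail_tau M (h 1) eps (real N) \<le> 4 * avg_dev_prob M h N (d N) e) sequentially"
    using eventually_ge_at_top[of 1]
  proof eventually_elim
    case (elim N)
    have "avg_dev_prob M h N (d N) e
        = prob {\<omega> \<in> space M. \<bar>(\<Sum>n\<in>{1..N}. h n \<omega>) - real N * d N\<bar> > e * real N}"
    proof -
      have "\<bar>(1 / real N) * s - d N\<bar> > e \<longleftrightarrow> \<bar>s - real N * d N\<bar> > e * real N" for s
      proof -
        have "s - real N * d N = ((1 / real N) * s - d N) * real N"
          using elim(3) by (simp add: field_simps)
        then have "\<bar>s - real N * d N\<bar> = \<bar>(1 / real N) * s - d N\<bar> * real N"
          by (simp add: abs_mult)
        then show ?thesis using elim(3) by simp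
      qed
      then show ?thesis by (simp only: avg_dev_prob_def)
    qed
    with tail_prob_le_deviation[of "e * real N" N "real N * d N"] elim e(1)
    show ?case by (simp add: tail_tau_def e(2) mult.assoc)
  qed
  have seq: "(\<lambda>N. tail_tau M (h 1) eps (real N)) \<longlonglongrightarrow> 0"
    by (rule tendsto_sandwich[OF _ ev tendsto_const tendsto_mult_right_zero[OF lim]])
       (simp add: tail_tau_def)
  have "filterlim (\<lambda>T::real. nat \<lfloor>T\<rfloor>) sequentially at_top"
    by (intro filterlim_compose[OF filterlim_nat_sequentially filterlim_floor_sequentially])
  from tendsto_mult_right_zero[OF filterlim_compose[OF seq this], of 2]
  have lim2: "((\<lambda>T::real. 2 * tail_tau M (h 1) eps (real (nat \<lfloor>T\<rfloor>))) \<longlongrightarrow> 0) at_top" .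
  \<comment> \<open>For \<open>T \<ge> 1\<close> the integer part is at least \<open>T / 2\<close>,
    and lowering the threshold only enlarges the tail event.\<close>
  have le: "tail_tau M (h 1) eps T \<le> 2 * tail_tau M (h 1) eps (real (nat \<lfloor>T\<rfloor>))" if "1 \<le> T" for T :: real
  proof -
    let ?N = "real (nat \<lfloor>T\<rfloor>)"
    have "1 \<le> \<lfloor>T\<rfloor>" using that by simp
    then have "?N = of_int \<lfloor>T\<rfloor>" "1 \<le> ?N" by simp_all
    then have N: "?N \<le> T" "T \<le> 2 * ?N" using floor_correct[of T] by linarith+
    have "eps * ?N \<le> eps * T" using N eps by (intro mult_left_mono) auto
    then have "prob {\<omega> \<in> space M. \<bar>h 1 \<omega>\<bar> > eps * T} \<le> prob {\<omega> \<in> space M. \<bar>h 1 \<omega>\<bar> > eps * ?N}"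
      by (intro finite_measure_mono) auto
    then have "T * prob {\<omega> \<in> space M. \<bar>h 1 \<omega>\<bar> > eps * T}
        \<le> (2 * ?N) * prob {\<omega> \<in> space M. \<bar>h 1 \<omega>\<bar> > eps * ?N}"
      using N that by (intro mult_mono) auto
    then show ?thesis by (simp add: tail_tau_def)
  qed
  show ?thesis
    by (rule tendsto_sandwich[OF _ _ tendsto_const lim2])
       (auto intro!: eventually_mono[OF eventually_ge_at_top[of 1]] le tail_tau_nonneg)
qed

text \<open>The tail condition passes to \<open>trunc_var\<close> through \<open>trunc_rho\<close>
  at the same level \<open>1\<close>, so both terms of the truncation bound vanish.\<close>

lemma avg_dev_prob_trunc_mean_tendsto:
  assumes tau: "((\<lambda>T. tail_tau M (h 1) 1 T) \<longlongrightarrow> 0) at_top" and eps: "0 < eps"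
  shows "(\<lambda>N. avg_dev_prob M h N (trunc_mean M (h 1) 1 (real N)) eps) \<longlonglongrightarrow> 0"
proof -
  have meas: "random_variable borel (h 1)" by (rule iid_measurable) simp
  have var: "((\<lambda>T. trunc_var M (h 1) 1 T) \<longlongrightarrow> 0) at_top"
    using tau by (simp add: tail_tau_tendsto_iff_trunc_rho[OF meas] trunc_var_tendsto_iff_trunc_rho[OF meas])
  have "((\<lambda>T. tail_tau M (h 1) 1 T + trunc_var M (h 1) 1 T / eps\<^sup>2) \<longlongrightarrow> 0) at_top"
    using tendsto_add[OF tau tendsto_divide_zero[OF var]] by simp
  from filterlim_compose[OF this filterlim_real_sequentially]
  have lim: "(\<lambda>N. tail_tau M (h 1) 1 (real N) + trunc_var M (h 1) 1 (real N) / eps\<^sup>2) \<longlonglongrightarrow> 0" .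
  show ?thesis
  proof (rule tendsto_sandwich[OF _ _ tendsto_const lim])
    show "eventually (\<lambda>N. 0 \<le> avg_dev_prob M h N (trunc_mean M (h 1) 1 (real N)) eps) sequentially"
      by (simp add: avg_dev_prob_def)
    show "eventually (\<lambda>N. avg_dev_prob M h N (trunc_mean M (h 1) 1 (real N)) eps
        \<le> tail_tau M (h 1) 1 (real N) + trunc_var M (h 1) 1 (real N) / eps\<^sup>2) sequentially"
      using eventually_ge_at_top[of 1] by eventually_elim (rule avg_dev_prob_trunc_mean_le[OF _ eps])
  qed
qed

end
end

section \<open>Assembly of the equivalences\<close>

theorem theorem4p1:
  fixes M :: "'a measure" and h :: "nat \<Rightarrow> 'a \<Rightarrow> real"
  assumes "prob_space M"
    and "prob_space.indep_vars M (\<lambda>_. borel) h {1..}"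
    and "\<And>n. n \<ge> 1 \<Longrightarrow> distr M borel (h n) = distr M borel (h 1)"
  defines "c_i \<equiv> (\<exists>d :: nat \<Rightarrow> real. \<forall>eps > 0.
              (\<lambda>N. avg_dev_prob M h N (d N) eps) \<longlonglongrightarrow> 0)"
    and "c_ii \<equiv> (\<forall>eps > 0. ((\<lambda>T. tail_tau M (h 1) eps T) \<longlongrightarrow> 0) at_top)"
    and "c_ii' \<equiv> (\<forall>eps > 0. ((\<lambda>T. trunc_sigma M (h 1) eps T) \<longlongrightarrow> 0) at_top)"
    and "c_ii'' \<equiv> (\<forall>eps > 0. ((\<lambda>T. trunc_var M (h 1) eps T) \<longlongrightarrow> 0) at_top)"
    and "c_ii''' \<equiv> (\<forall>eps > 0. ((\<lambda>T. trunc_rho M (h 1) eps T) \<longlongrightarrow> 0) at_top)"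
    and "c_iii \<equiv> (\<forall>eps > 0. ((\<lambda>T. (1 / T) *
              (LBINT t=ereal 0..ereal T. tail_tau M (h 1) eps t)) \<longlongrightarrow> 0) at_top)"
    and "c_iii' \<equiv> (\<forall>eps > 0. ((\<lambda>T. T *
              (LBINT t=ereal T..\<infinity>. trunc_sigma M (h 1) eps t / t\<^sup>2)) \<longlongrightarrow> 0) at_top)"
    and "c_iii'' \<equiv> (\<forall>eps > 0. ((\<lambda>T. T *
              (LBINT t=ereal T..\<infinity>. trunc_var M (h 1) eps t / t\<^sup>2)) \<longlongrightarrow> 0) at_top)"
  shows "(c_i \<longleftrightarrow> c_ii) \<and> (c_i \<longleftrightarrow> c_ii') \<and> (c_i \<longleftrightarrow> c_ii'') \<and> (c_i \<longleftrightarrow> c_ii''')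
         \<and> (c_i \<longleftrightarrow> c_iii) \<and> (c_i \<longleftrightarrow> c_iii') \<and> (c_i \<longleftrightarrow> c_iii'')
         \<and> (c_ii \<longrightarrow> (\<forall>eps > 0.
               (\<lambda>N. avg_dev_prob M h N (trunc_mean M (h 1) 1 (real N)) eps) \<longlonglongrightarrow> 0))"
proof -
  interpret prob_space M by fact
  note iid = assms(2,3)
  have meas: "random_variable borel (h 1)" by (rule iid_measurable[OF iid]) simp_all
  \<comment> \<open>Each equivalence holds for every \<open>eps\<close> separately, so it survives
    the quantifier.\<close>
  have eqs: "c_ii \<longleftrightarrow> c_ii'''" "c_ii' \<longleftrightarrow> c_ii'''" "c_ii'' \<longleftrightarrow> c_ii'''"
    "c_iii \<longleftrightarrow> c_ii'''" "c_iii' \<longleftrightarrow> c_ii'''" "c_iii'' \<longleftrightarrow> c_ii'''"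
    unfolding c_ii_def c_ii'_def c_ii''_def c_ii'''_def c_iii_def c_iii'_def c_iii''_def
    using tail_tau_tendsto_iff_trunc_rho[OF meas] trunc_sigma_tendsto_iff_trunc_rho[OF meas]
      trunc_var_tendsto_iff_trunc_rho[OF meas] average_tail_tau_tendsto_iff_trunc_rho[OF meas]
      tail_integral_trunc_sigma_tendsto_iff_trunc_rho[OF meas]
      tail_integral_trunc_var_tendsto_iff_trunc_rho[OF meas]
    by blast+
  \<comment> \<open>This is the last conjunct, and it also supplies the centring constants that
    witness \<open>c_i\<close>.\<close>
  have wlln: "\<forall>eps > 0. (\<lambda>N. avg_dev_prob M h N (trunc_mean M (h 1) 1 (real N)) eps) \<longlonglongrightarrow> 0" if c_ii
    using avg_dev_prob_trunc_mean_tendsto[OF iid] that unfolding c_ii_def by simp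
  moreover have "c_i \<longleftrightarrow> c_ii"
  proof
    assume c_i
    then show c_ii
      using tail_tau_tendsto_of_avg_dev_prob[OF iid] unfolding c_i_def c_ii_def by blast
  next
    assume c_ii
    from wlln[OF this] show c_i
      unfolding c_i_def by (rule exI[where x = "\<lambda>N. trunc_mean M (h 1) 1 (real N)"])
  qed
  ultimately show ?thesis using eqs by blast
qed

end
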